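(* Let $\mathcal{X}$ be a locally compact Polish space, $\mathcal{G}$ a separable Hilbert space, $\mathcal{Y}$ a complete subset of $\mathcal{G}$, and $\mathcal{H}$ a separable $\mathcal{G}$-valued reproducing kernel Hilbert space (RKHS) of continuous functions on $\mathcal{X}$ with bounded kernel $K$ and continuous feature map $\Phi:x\mapsto K(\cdot,x)$. Assume that $C_{\mathrm b}(\mathcal{X}\times\mathcal{Y};\mathcal{H})$ is separable. Let $L:\mathcal{X}\times\mathcal{Y}\times\mathcal{G}\to[0,\infty)$ be a convex, continuously differentiable, locally Lipschitz continuous, and locally bounded loss function. Let $Z=(X,Y)$ be an $\mathcal{X}\times\mathcal{Y}$-valued process, and assume that $Z$ is empirically weakly converging (EWC) in probability (resp. almost surely) with limit measure $J$. Assume that $\mathcal{H}$ is $(L,J)$-rich, $\mathbb{P}$-almost surely. Then there exists a sequence of strictly positive real numbers $(\lambda_n)_{n\ge1}$ such that $\lim_{n\to\infty}\lambda_n=0$ and the $(\lambda_n)$-SVM is $L$-consistent (resp. strongly $L$-consistent) for $Z$, that is, $$\lim_{n\to\infty}\mathcal{R}_{L,J}\big(f_{Z_{1:n},\lambda_n}\big)=\mathcal{R}^\star_{L,J},$$ where the convergence is in probability (resp. almost sure).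
   Context: All random variables are defined on a complete standard Borel probability space $(\Omega,\mathcal{A},\mathbb{P})$. Polish spaces carry their Borel $\sigma$-algebra; products carry the product topology. $\mathcal{P}(\mathcal{X})$ is the set of Borel probability measures on $\mathcal{X}$ with the topology of weak convergence. A random measure on $\mathcal{X}$ is a measurable map $\Omega\to\mathcal{P}(\mathcal{X})$. $C_{\mathrm b}(\mathcal{X}\times\mathcal{Y};\mathcal{H})$ is the set of continuous bounded functions $\mathcal{X}\times\mathcal{Y}\to\mathcal{H}$ with the topology of uniform convergence. The empirical measure of a process (or finite sequence) $Z$ is $\eta_n^Z=\frac1n\sum_{i=1}^n\delta_{Z_i}$, and $Z_{1:n}=(Z_1,\dots,Z_n)$. EWC: let $d$ be a metric metrizing weak convergence on $\mathcal{P}(\mathcal{X}\times\mathcal{Y})$. $Z$ is EWC in probability (resp. almost surely) with limit measure the random measure $J$ on $\mathcal{X}\times\mathcal{Y}$ if $d(\eta_n^Z,J)\to0$ in probability (resp. almost surely). RKHS: a $\mathcal{G}$-valued RKHS $\mathcal{H}$ on $\mathcal{X}$ is a Hilbert space of functions $\mathcal{X}\to\mathcal{G}$ for which every evaluation operator $S_x:f\mapsto f(x)$ is continuous; $K(\cdot,x):=S_x^\star:\mathcal{G}\to\mathcal{H}$ and $K(x,x'):=S_xS_{x'}^\star$, a bounded operator on $\mathcal{G}$. $K$ is bounded if $\sup_{x}\sqrt{\lVert K(x,x)\rVert}<\infty$ (operator norm). The feature map $\Phi$ takes values in the bounded operators $\mathcal{G}\to\mathcal{H}$ with the operator norm. Loss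 functions: a loss function is a measurable $L:\mathcal{X}\times\mathcal{Y}\times\mathcal{G}\to[0,\infty)$. It is convex if $L(x,y,\cdot)$ is convex for all $(x,y)$; locally bounded if $L$ restricted to $\mathcal{X}\times\mathcal{Y}\times A$ is bounded for every bounded $A\subset\mathcal{G}$; locally Lipschitz continuous if for all $a>0$, $$\lvert L\rvert_{a,1}:=\sup_{\substack{(t,t')\in\mathcal{G}^2\\0<\lVert t-t'\rVert_{\mathcal{G}}\le2a}}\ \sup_{x\in\mathcal{X},\,y\in\mathcal{Y}}\frac{\lvert L(x,y,t)-L(x,y,t')\rvert}{\lVert t-t'\rVert_{\mathcal{G}}}<\infty.$$ It is continuously differentiable if $L(x,y,\cdot)$ is Fréchet differentiable on $\mathcal{G}$ for all $(x,y)$, with gradient $\nabla L(x,y,t)\in\mathcal{G}$, and $(x,y,t)\mapsto\nabla L(x,y,t)$ is continuous. Risk: for $I\in\mathcal{P}(\mathcal{X}\times\mathcal{Y})$ and measurable $f:\mathcal{X}\to\mathcal{G}$, $\mathcal{R}_{L,I}(f)=\int L(x,y,f(x))\,\mathrm{d}I(x,y)$ and $\mathcal{R}^\star_{L,I}=\inf\{\mathcal{R}_{L,I}(f): f:\mathcal{X}\to\mathcal{G}\text{ measurable}\}$. $\mathcal{H}$ is $(L,I)$-rich if $\inf_{f\in\mathcal{H}}\mathcal{R}_{L,I}(f)=\mathcal{R}^\star_{L,I}$. For a random measure $J$ these quantities are evaluated pointwise in $\omega\in\Omega$. SVM: for $\lambda>0$ and a finite training set $Z\in(\mathcal{X}\times\mathcal{Y})^n$,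 $f_{Z,\lambda}$ is the unique minimizer over $f\in\mathcal{H}$ of $\mathcal{R}_{L,\eta_n^Z}(f)+\lambda\lVert f\rVert_{\mathcal{H}}^2$. The $(\lambda_n)$-SVM is the learning method that maps $Z_{1:n}$ to $f_{Z_{1:n},\lambda_n}$. *)

theory Defs
  imports "HOL-Analysis.Analysis" "HOL-Probability.Giry_Monad"
begin

definition borel_of :: "'a topology \<Rightarrow> 'a measure" where
  "borel_of T = sigma (topspace T) {U. openin T U}"

text \<open>The completion of a Borel probability measure on a standard Borel space, i.e. on a
  measurable space whose sigma-algebra is generated by some Polish topology.\<close>

definition standard_borel :: "'w measure \<Rightarrow> bool" where
  "standard_borel M \<longleftrightarrow>
     (\<exists>T. completely_metrizable_space T \<and> second_countable T \<and>
          space M = topspace T \<and> sets M = sets (borel_of T))"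

definition complete_standard_borel_prob_space :: "'w measure \<Rightarrow> bool" where
  "complete_standard_borel_prob_space M \<longleftrightarrow>
     (\<exists>M0. standard_borel M0 \<and> prob_space M0 \<and> M = completion M0)"


section \<open>Weak convergence and random measures\<close>

text \<open>Throughout, a subset \<open>S\<close> of a topological space carries the subspace topology, and its Borel
  sigma-algebra is that of \<open>restrict_space borel S\<close>.\<close>

definition borel_probs :: "'a::topological_space set \<Rightarrow> 'a measure set" where
  "borel_probs S = {\<mu>. prob_space \<mu> \<and> sets \<mu> = sets (restrict_space borel S)}"

definition weak_topology :: "'a::topological_space set \<Rightarrow> 'a measure topology" where
  "weak_topology S = topology_generated_by
     {{\<mu> \<in> borel_probs S. (\<integral>z. f z \<partial>\<mu>) \<in> U} | (f :: 'a \<Rightarrow> real) U.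
        continuous_on S f \<and> bounded (f ` S) \<and> open U}"

definition metrizes_weak_convergence ::
  "'a::topological_space set \<Rightarrow> ('a measure \<Rightarrow> 'a measure \<Rightarrow> real) \<Rightarrow> bool" where
  "metrizes_weak_convergence S d \<longleftrightarrow>
     Metric_space (borel_probs S) d \<and>
     Metric_space.mtopology (borel_probs S) d = weak_topology S"

definition random_measure ::
  "'w measure \<Rightarrow> 'a::topological_space set \<Rightarrow> ('w \<Rightarrow> 'a measure) \<Rightarrow> bool" where
  "random_measure M S J \<longleftrightarrow> J \<in> measurable M (borel_of (weak_topology S))"

text \<open>Sequences are indexed by \<open>n \<ge> 1\<close>: the first \<open>n\<close> observations are \<open>z 1, \<dots>, z n\<close>, and the
  value at index 0 is irrelevant.\<close>

definition empirical_measure ::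
  "'a::topological_space set \<Rightarrow> nat \<Rightarrow> (nat \<Rightarrow> 'a) \<Rightarrow> 'a measure" where
  "empirical_measure S n z =
     measure_of S (sets (restrict_space borel S))
       (\<lambda>A. (\<Sum>i=1..n. emeasure (return (restrict_space borel S) (z i)) A) / of_nat n)"

definition tends_to_0_in_prob :: "'w measure \<Rightarrow> (nat \<Rightarrow> 'w \<Rightarrow> ennreal) \<Rightarrow> bool" where
  "tends_to_0_in_prob M D \<longleftrightarrow>
     (\<forall>n\<ge>1. D n \<in> borel_measurable M) \<and>
     (\<forall>e>0. (\<lambda>n. measure M {w \<in> space M. D n w > ennreal e}) \<longlonglongrightarrow> 0)"

definition ewc_in_prob ::
  "'w measure \<Rightarrow> 'a::topological_space set \<Rightarrow> ('a measure \<Rightarrow> 'a measure \<Rightarrow> real) \<Rightarrow>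
   (nat \<Rightarrow> 'w \<Rightarrow> 'a) \<Rightarrow> ('w \<Rightarrow> 'a measure) \<Rightarrow> bool" where
  "ewc_in_prob M S d Z J \<longleftrightarrow>
     tends_to_0_in_prob M (\<lambda>n w. ennreal (d (empirical_measure S n (\<lambda>i. Z i w)) (J w)))"

definition ewc_almost_surely ::
  "'w measure \<Rightarrow> 'a::topological_space set \<Rightarrow> ('a measure \<Rightarrow> 'a measure \<Rightarrow> real) \<Rightarrow>
   (nat \<Rightarrow> 'w \<Rightarrow> 'a) \<Rightarrow> ('w \<Rightarrow> 'a measure) \<Rightarrow> bool" where
  "ewc_almost_surely M S d Z J \<longleftrightarrow>
     (AE w in M. (\<lambda>n. d (empirical_measure S n (\<lambda>i. Z i w)) (J w)) \<longlonglongrightarrow> 0)"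


section \<open>Vector-valued reproducing kernel Hilbert spaces\<close>

text \<open>A Hilbert space of functions is given by a Hilbert space \<open>'h\<close> together with an injective
  linear map \<open>app\<close> sending each element to the function it stands for.\<close>

definition rkhs :: "('h::{real_inner, complete_space} \<Rightarrow> 'x \<Rightarrow> 'g::{real_inner, complete_space}) \<Rightarrow> bool"
  where "rkhs app \<longleftrightarrow> inj app \<and> (\<forall>x. bounded_linear (\<lambda>f. app f x))"

definition eval_op ::
  "('h::{real_inner, complete_space} \<Rightarrow> 'x \<Rightarrow> 'g::{real_inner, complete_space}) \<Rightarrow> 'x \<Rightarrow> 'h \<Rightarrow>\<^sub>L 'g"
  where "eval_op app x = Blinfun (\<lambda>f. app f x)"

definition feature_map ::
  "('h::{real_inner, complete_space} \<Rightarrow> 'x \<Rightarrow> 'g::{real_inner, complete_space}) \<Rightarrow> 'x \<Rightarrow> 'g \<Rightarrow>\<^sub>L 'h"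
  where "feature_map app x = Blinfun (adjoint (blinfun_apply (eval_op app x)))"

definition rkhs_kernel ::
  "('h::{real_inner, complete_space} \<Rightarrow> 'x \<Rightarrow> 'g::{real_inner, complete_space}) \<Rightarrow> 'x \<Rightarrow> 'x \<Rightarrow> 'g \<Rightarrow>\<^sub>L 'g"
  where "rkhs_kernel app x x' = eval_op app x o\<^sub>L feature_map app x'"

definition bounded_kernel ::
  "('h::{real_inner, complete_space} \<Rightarrow> 'x \<Rightarrow> 'g::{real_inner, complete_space}) \<Rightarrow> bool"
  where "bounded_kernel app \<longleftrightarrow> bdd_above (range (\<lambda>x. sqrt (norm (rkhs_kernel app x x))))"


section \<open>Loss functions\<close>

text \<open>A loss on \<open>X \<times> Y \<times> G\<close>, with \<open>X\<close> the whole type \<open>'x\<close>, \<open>G\<close> the whole type \<open>'g\<close> and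
  \<open>Y\<close> a subset of \<open>G\<close>; values at \<open>y \<notin> Y\<close> are irrelevant.\<close>

definition loss_function ::
  "'g set \<Rightarrow> ('x::topological_space \<Rightarrow> 'g::real_inner \<Rightarrow> 'g \<Rightarrow> real) \<Rightarrow> bool" where
  "loss_function Y L \<longleftrightarrow>
     (\<forall>x. \<forall>y\<in>Y. \<forall>t. 0 \<le> L x y t) \<and>
     (\<lambda>(x, y, t). L x y t) \<in> borel_measurable (restrict_space borel (UNIV \<times> Y \<times> UNIV))"

definition convex_loss :: "'g set \<Rightarrow> ('x \<Rightarrow> 'g::real_inner \<Rightarrow> 'g \<Rightarrow> real) \<Rightarrow> bool" where
  "convex_loss Y L \<longleftrightarrow> (\<forall>x. \<forall>y\<in>Y. convex_on UNIV (L x y))"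

definition locally_bounded_loss :: "'g set \<Rightarrow> ('x \<Rightarrow> 'g::real_inner \<Rightarrow> 'g \<Rightarrow> real) \<Rightarrow> bool" where
  "locally_bounded_loss Y L \<longleftrightarrow>
     (\<forall>A. bounded A \<longrightarrow> bounded ((\<lambda>(x, y, t). L x y t) ` (UNIV \<times> Y \<times> A)))"

definition locally_Lipschitz_loss :: "'g set \<Rightarrow> ('x \<Rightarrow> 'g::real_inner \<Rightarrow> 'g \<Rightarrow> real) \<Rightarrow> bool" where
  "locally_Lipschitz_loss Y L \<longleftrightarrow>
     (\<forall>a>0. bdd_above {\<bar>L x y t - L x y t'\<bar> / norm (t - t') | x y t t'.
                          y \<in> Y \<and> 0 < norm (t - t') \<and> norm (t - t') \<le> 2 * a})"

definition continuously_differentiable_loss ::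
  "'g set \<Rightarrow> ('x::topological_space \<Rightarrow> 'g::real_inner \<Rightarrow> 'g \<Rightarrow> real) \<Rightarrow> bool" where
  "continuously_differentiable_loss Y L \<longleftrightarrow>
     (\<exists>grad. (\<forall>x. \<forall>y\<in>Y. \<forall>t. GDERIV (L x y) t :> grad x y t) \<and>
             continuous_on (UNIV \<times> Y \<times> UNIV) (\<lambda>(x, y, t). grad x y t))"


section \<open>Risks, SVMs and consistency\<close>

definition risk ::
  "('x \<Rightarrow> 'g \<Rightarrow> 'g \<Rightarrow> real) \<Rightarrow> ('x \<times> 'g) measure \<Rightarrow> ('x \<Rightarrow> 'g) \<Rightarrow> ennreal" where
  "risk L I f = (\<integral>\<^sup>+(x, y). ennreal (L x y (f x)) \<partial>I)"

definition optimal_risk ::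
  "('x::topological_space \<Rightarrow> 'g::topological_space \<Rightarrow> 'g \<Rightarrow> real) \<Rightarrow> ('x \<times> 'g) measure \<Rightarrow> ennreal" where
  "optimal_risk L I = (INF f\<in>borel_measurable borel. risk L I f)"

definition rich ::
  "('x::topological_space \<Rightarrow> 'g::topological_space \<Rightarrow> 'g \<Rightarrow> real) \<Rightarrow> ('h \<Rightarrow> 'x \<Rightarrow> 'g) \<Rightarrow>
   ('x \<times> 'g) measure \<Rightarrow> bool" where
  "rich L app I \<longleftrightarrow> (INF f. risk L I (app f)) = optimal_risk L I"

definition svm ::
  "'g set \<Rightarrow> ('x::topological_space \<Rightarrow> 'g::topological_space \<Rightarrow> 'g \<Rightarrow> real) \<Rightarrow>
   ('h::real_normed_vector \<Rightarrow> 'x \<Rightarrow> 'g) \<Rightarrow> nat \<Rightarrow> (nat \<Rightarrow> 'x \<times> 'g) \<Rightarrow> real \<Rightarrow> 'h" where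
  "svm Y L app n z lam =
     (THE f. is_arg_min
        (\<lambda>f. risk L (empirical_measure (UNIV \<times> Y) n z) (app f) + ennreal (lam * (norm f)\<^sup>2))
        (\<lambda>_. True) f)"

definition svm_risk ::
  "'g set \<Rightarrow> ('x::topological_space \<Rightarrow> 'g::topological_space \<Rightarrow> 'g \<Rightarrow> real) \<Rightarrow>
   ('h::real_normed_vector \<Rightarrow> 'x \<Rightarrow> 'g) \<Rightarrow> (nat \<Rightarrow> real) \<Rightarrow> (nat \<Rightarrow> 'w \<Rightarrow> 'x \<times> 'g) \<Rightarrow>
   ('w \<Rightarrow> ('x \<times> 'g) measure) \<Rightarrow> nat \<Rightarrow> 'w \<Rightarrow> ennreal" where
  "svm_risk Y L app lam Z J n w = risk L (J w) (app (svm Y L app n (\<lambda>i. Z i w) (lam n)))"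

text \<open>Subtraction on \<^typ>\<open>ennreal\<close> is truncated at 0, so \<open>(a - b) + (b - a)\<close> is the distance
  \<open>\<bar>a - b\<bar>\<close> whenever \<open>a\<close> or \<open>b\<close> is finite (and \<open>\<infinity>\<close> if both are infinite).\<close>

definition svm_consistent ::
  "'w measure \<Rightarrow> 'g set \<Rightarrow> ('x::topological_space \<Rightarrow> 'g::topological_space \<Rightarrow> 'g \<Rightarrow> real) \<Rightarrow>
   ('h::real_normed_vector \<Rightarrow> 'x \<Rightarrow> 'g) \<Rightarrow> (nat \<Rightarrow> real) \<Rightarrow> (nat \<Rightarrow> 'w \<Rightarrow> 'x \<times> 'g) \<Rightarrow>
   ('w \<Rightarrow> ('x \<times> 'g) measure) \<Rightarrow> bool" where
  "svm_consistent M Y L app lam Z J \<longleftrightarrow>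
     tends_to_0_in_prob M (\<lambda>n w.
       (svm_risk Y L app lam Z J n w - optimal_risk L (J w)) +
       (optimal_risk L (J w) - svm_risk Y L app lam Z J n w))"

definition svm_strongly_consistent ::
  "'w measure \<Rightarrow> 'g set \<Rightarrow> ('x::topological_space \<Rightarrow> 'g::topological_space \<Rightarrow> 'g \<Rightarrow> real) \<Rightarrow>
   ('h::real_normed_vector \<Rightarrow> 'x \<Rightarrow> 'g) \<Rightarrow> (nat \<Rightarrow> real) \<Rightarrow> (nat \<Rightarrow> 'w \<Rightarrow> 'x \<times> 'g) \<Rightarrow>
   ('w \<Rightarrow> ('x \<times> 'g) measure) \<Rightarrow> bool" where
  "svm_strongly_consistent M Y L app lam Z J \<longleftrightarrow>
     (AE w in M. (\<lambda>n. svm_risk Y L app lam Z J n w) \<longlonglongrightarrow> optimal_risk L (J w))"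

end

theory Submission
  imports Defs
begin

text \<open>Write \<open>F s f = L x y (f x)\<close> for \<open>s = (x, y)\<close>. On the RKHS this is convex in \<open>f\<close> with a bounded
  gradient \<open>G s f = \<Phi> x (\<nabla>L x y (f x))\<close> that is continuous in \<open>s\<close> and in \<open>f\<close>. If \<open>p\<close> and \<open>p'\<close>
  minimize the regularized risks for \<open>J\<close> and \<open>I\<close>, strong convexity and the first-order condition at \<open>p\<close>
  give \<open>\<lambda> \<parallel>p' - p\<parallel>\<^sup>2 \<le> \<langle>\<integral> G s p dJ - \<integral> G s p dI, p' - p\<rangle>\<close>. Weak convergence forces norm
  convergence of integrals of bounded continuous maps into a separable Hilbert space, so \<open>p' \<rightarrow> p\<close> as
  \<open>I \<rightarrow> J\<close> weakly. Hence for fixed \<open>\<lambda>\<close> the risk of the SVM converges to that of the minimizer for \<open>J\<close>,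
  which tends to the optimal risk as \<open>\<lambda> \<rightarrow> 0\<close> by richness; letting \<open>\<lambda>\<close> tend to 0 slowly enough
  combines both limits.\<close>

section \<open>Minimization and adjoints in Hilbert spaces\<close>

text \<open>Two obstacles shape the proof. The sequence \<open>lam\<close> must be deterministic,
  whereas the sample size from which the empirical minimizer is close to that of \<open>J\<close>
  depends on the sample point. The slow index is therefore read off from probabilities of bad
  events, and pathwise continuity is carried over to convergence in probability along subsequences.
  The other obstacle is measurability: \<open>F\<close> is merely measurable in the data point, so a
  risk under a random measure is not the integral of a continuous function, and only integrals of
  bounded continuous functions are known to be measurable in the sample point. Increments of
  \<open>F\<close> between two elements of the RKHS are continuous in the data point, and
  differences of risks are all that consistency involves. Norm convergence of vector integrals is
  expressed through inner products with \<open>h\<close>, uniformly in \<open>h\<close>, so that no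
  vector-valued integral appears.\<close>

lemma norm_midpoint_sq:
  fixes f h :: "'a::real_inner"
  shows "(norm ((f + h) /\<^sub>R 2))\<^sup>2 = ((norm f)\<^sup>2 + (norm h)\<^sup>2) / 2 - (norm (f - h))\<^sup>2 / 4"
  by (simp add: power2_norm_eq_inner inner_add_left inner_add_right inner_diff_left inner_diff_right
      inner_commute field_simps)

text \<open>The midpoint inequality bounds the distance of two near-minimizers by their excess over
  the infimum, so every minimizing sequence is Cauchy and completeness replaces weak
  compactness.\<close>

lemma strongly_convex_minimizer:
  fixes \<phi> :: "'a::{real_inner, complete_space} \<Rightarrow> real"
  assumes cont: "continuous_on UNIV \<phi>" and bdd: "\<And>f. b \<le> \<phi> f" and lam: "lam > 0"
    and mid: "\<And>f h. \<phi> ((f + h) /\<^sub>R 2) \<le> (\<phi> f + \<phi> h) / 2 - lam / 4 * (norm (f - h))\<^sup>2"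
  obtains p where "\<And>f. \<phi> p + lam / 2 * (norm (f - p))\<^sup>2 \<le> \<phi> f"
proof -
  define m where "m = Inf (range \<phi>)"
  have bd: "bdd_below (range \<phi>)"
    using bdd by (intro bdd_belowI2)
  have m_le: "m \<le> \<phi> f" for f
    unfolding m_def by (intro cInf_lower bd) auto
  have "\<exists>x. \<phi> x < m + 1 / real (Suc n)" for n
  proof -
    have "\<exists>y\<in>range \<phi>. y < m + 1 / real (Suc n)"
      by (subst cInf_less_iff[symmetric]) (auto simp: bd m_def)
    then show ?thesis by auto
  qed
  then obtain x where x: "\<And>n. \<phi> (x n) < m + 1 / real (Suc n)" by metis
  have close: "lam / 4 * (norm (x i - x j))\<^sup>2 \<le> 1 / real (Suc N)" if "i \<ge> N" "j \<ge> N" for i j N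
  proof -
    have "1 / real (Suc i) \<le> 1 / real (Suc N)" "1 / real (Suc j) \<le> 1 / real (Suc N)"
      using that by (auto simp: frac_le)
    then have "\<phi> (x i) \<le> m + 1 / real (Suc N)" "\<phi> (x j) \<le> m + 1 / real (Suc N)"
      using x[of i] x[of j] by linarith+
    moreover have "m \<le> (\<phi> (x i) + \<phi> (x j)) / 2 - lam / 4 * (norm (x i - x j))\<^sup>2"
      using mid m_le by (rule order_trans[rotated])
    ultimately show ?thesis by argo
  qed
  have "Cauchy x"
  proof (rule metric_CauchyI)
    fix e :: real assume e: "e > 0"
    obtain N where N: "1 / real (Suc N) < lam / 4 * e\<^sup>2"
      using reals_Archimedean[of "lam / 4 * e\<^sup>2"] e lam by (auto simp: field_simps)
    have "dist (x i) (x j) < e" if "i \<ge> N" "j \<ge> N" for i j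
    proof -
      have "lam / 4 * (norm (x i - x j))\<^sup>2 < lam / 4 * e\<^sup>2"
        using close[OF that] N by linarith
      then have "(norm (x i - x j))\<^sup>2 < e\<^sup>2" using lam by simp
      then show ?thesis using e by (simp add: dist_norm power_less_imp_less_base)
    qed
    then show "\<exists>N. \<forall>m\<ge>N. \<forall>n\<ge>N. dist (x m) (x n) < e" by blast
  qed
  then obtain p where p: "x \<longlonglongrightarrow> p"
    using Cauchy_convergent convergent_def by blast
  have "\<phi> p \<le> m"
  proof (rule LIMSEQ_le)
    show "(\<lambda>n. \<phi> (x n)) \<longlonglongrightarrow> \<phi> p"
      using cont p continuous_on_tendsto_compose[OF cont p] by simp
    show "(\<lambda>n. m + 1 / real (Suc n)) \<longlonglongrightarrow> m"
      using tendsto_add[OF tendsto_const LIMSEQ_inverse_real_of_nat] by (simp add: inverse_eq_divide)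
    show "\<exists>N. \<forall>n\<ge>N. \<phi> (x n) \<le> m + 1 / real (Suc n)"
      using x less_imp_le by blast
  qed
  \<comment> \<open>The midpoint of \<open>f\<close> and \<open>p\<close> has value at least
    \<open>m\<close>, and \<open>\<phi> p \<le> m\<close>; the midpoint inequality rearranges to
    quadratic growth with the constant \<open>lam / 2\<close>.\<close>
  then have "\<phi> p + lam / 2 * (norm (f - p))\<^sup>2 \<le> \<phi> f" for f
    using mid[of f p] m_le[of "(f + p) /\<^sub>R 2"] m_le[of f] by (simp add: field_simps)
  then show thesis by (rule that)
qed

text \<open>At \<open>t = - b / k\<close> with \<open>k > a\<close> the expression is a multiple of
  \<open>a - k\<close> by a nonnegative factor that vanishes only for \<open>b = 0\<close>. The
  choice \<open>k = \<bar>a\<bar> + 1\<close> is positive for either sign of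
  \<open>a\<close>.\<close>

lemma nonneg_quadratic_linear_coeff:
  fixes a b :: real
  assumes "\<And>t. 0 \<le> t\<^sup>2 * a + t * b"
  shows "b = 0"
proof (rule ccontr)
  assume b: "b \<noteq> 0"
  define k where "k = \<bar>a\<bar> + 1"
  have k: "k > 0" unfolding k_def by simp
  have "0 \<le> (- b / k)\<^sup>2 * a + (- b / k) * b" by (rule assms)
  also have "\<dots> = (b\<^sup>2 / k\<^sup>2) * (a - k)"
    using k by (simp add: field_simps power2_eq_square)
  finally have "0 \<le> a - k"
    using b k by (simp add: zero_le_mult_iff zero_le_divide_iff)
  then show False unfolding k_def by linarith
qed

text \<open>The representing vector minimizes the squared norm minus \<open>2 * l f\<close>; the
  first-order condition in direction \<open>h\<close> reads \<open>l h = p \<bullet> h\<close>.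
  Completing the square gives the lower bound.\<close>

lemma Riesz_representation:
  fixes l :: "'a::{real_inner, complete_space} \<Rightarrow> real"
  assumes "bounded_linear l"
  obtains p where "\<And>h. l h = p \<bullet> h"
proof -
  interpret bounded_linear l by fact
  obtain K where K: "\<And>f. norm (l f) \<le> norm f * K" using bounded by blast
  define \<phi> where "\<phi> f = (norm f)\<^sup>2 - 2 * l f" for f
  have below: "- K\<^sup>2 \<le> \<phi> f" for f
  proof -
    have "0 \<le> (norm f - K)\<^sup>2" by simp
    moreover have "l f \<le> norm f * K" using K[of f] by simp
    ultimately show ?thesis unfolding \<phi>_def by (simp add: power2_diff)
  qed
  have mid: "\<phi> ((f + h) /\<^sub>R 2) \<le> (\<phi> f + \<phi> h) / 2 - 1 / 4 * (norm (f - h))\<^sup>2" for f h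
    unfolding \<phi>_def norm_midpoint_sq by (simp add: scaleR add field_simps)
  have "continuous_on UNIV \<phi>"
    unfolding \<phi>_def by (intro continuous_intros linear_continuous_on assms)
  then obtain p where p: "\<And>f. \<phi> p + 1 / 2 * (norm (f - p))\<^sup>2 \<le> \<phi> f"
    using strongly_convex_minimizer[of \<phi> "- K\<^sup>2" 1] below mid by (metis zero_less_one)
  have "l h = p \<bullet> h" for h
  proof -
    have "0 \<le> t\<^sup>2 * (norm h)\<^sup>2 + t * (2 * (p \<bullet> h - l h))" for t
    proof -
      have "\<phi> p \<le> \<phi> (p + t *\<^sub>R h)"
        using p[of "p + t *\<^sub>R h"] zero_le_power2[of "norm (p + t *\<^sub>R h - p)"] by linarith
      moreover have "(norm (p + t *\<^sub>R h))\<^sup>2 = (norm p)\<^sup>2 + 2 * t * (p \<bullet> h) + t\<^sup>2 * (norm h)\<^sup>2"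
        unfolding power2_norm_eq_inner
        by (simp add: inner_add_left inner_add_right inner_commute power2_eq_square algebra_simps)
      ultimately show ?thesis unfolding \<phi>_def by (simp add: add scaleR algebra_simps)
    qed
    from nonneg_quadratic_linear_coeff[OF this] show ?thesis by simp
  qed
  then show thesis by (rule that)
qed

text \<open>\<open>adjoint\<close> is defined by choice, so its characteristic equation holds only
  once some adjoint is known to exist; Riesz representation supplies one.\<close>

lemma inner_adjoint:
  fixes A :: "'a::{real_inner, complete_space} \<Rightarrow> 'b::real_inner"
  assumes "bounded_linear A"
  shows "A x \<bullet> y = x \<bullet> adjoint A y"
proof -
  have "\<exists>p. \<forall>x. A x \<bullet> y = x \<bullet> p" for y
  proof -
    have "bounded_linear (\<lambda>x. A x \<bullet> y)"
      using bounded_linear_compose[OF bounded_linear_inner_left assms] by simp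
    then show ?thesis using Riesz_representation by (metis inner_commute)
  qed
  then obtain B where "\<forall>x y. A x \<bullet> y = x \<bullet> B y" by metis
  then have "\<forall>x y. A x \<bullet> y = x \<bullet> adjoint A y"
    unfolding adjoint_def by (rule someI[where P = "\<lambda>B. \<forall>x y. A x \<bullet> y = x \<bullet> B y"])
  then show ?thesis by blast
qed

text \<open>Linearity follows by testing against all vectors, and the bound from Cauchy-Schwarz
  applied to \<open>A (adjoint A x) \<bullet> x\<close>. It is what lets the \<open>Blinfun\<close>
  in \<open>feature_map\<close> unfold.\<close>

lemma bounded_linear_adjoint:
  fixes A :: "'a::{real_inner, complete_space} \<Rightarrow> 'b::real_inner"
  assumes "bounded_linear A"
  shows "bounded_linear (adjoint A)"
proof -
  note adj = inner_adjoint[OF assms, symmetric]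
  have eqI: "u = v" if "\<And>x. x \<bullet> u = x \<bullet> v" for u v :: 'a
    using that[of "u - v"] inner_eq_zero_iff[of "u - v"] by (simp add: inner_diff_right)
  obtain K where K0: "0 \<le> K" and K: "\<And>x. norm (A x) \<le> norm x * K"
    using bounded_linear.nonneg_bounded[OF assms] by blast
  show ?thesis
  proof (rule bounded_linear_intro)
    show "adjoint A (x + y) = adjoint A x + adjoint A y" for x y
      by (rule eqI) (simp add: adj inner_add_right)
    show "adjoint A (r *\<^sub>R x) = r *\<^sub>R adjoint A x" for r x
      by (rule eqI) (simp add: adj)
    show "norm (adjoint A x) \<le> norm x * K" for x
    proof -
      have "norm (adjoint A x) * norm (adjoint A x) = A (adjoint A x) \<bullet> x"
        by (simp add: adj[symmetric] power2_norm_eq_inner[symmetric] power2_eq_square)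
      also have "\<dots> \<le> (norm (adjoint A x) * K) * norm x"
        using norm_cauchy_schwarz K by (meson mult_right_mono norm_ge_zero order_trans)
      finally have "norm (adjoint A x) * norm (adjoint A x) \<le> norm (adjoint A x) * (norm x * K)"
        by (simp add: mult_ac)
      then show ?thesis
        using K0 by (cases "adjoint A x = 0") (auto simp: mult_le_cancel_left_pos)
    qed
  qed
qed


section \<open>Weak convergence\<close>

definition weakly_converges ::
  "'s::topological_space set \<Rightarrow> (nat \<Rightarrow> 's measure) \<Rightarrow> 's measure \<Rightarrow> bool" where
  "weakly_converges S I J \<longleftrightarrow>
     (\<forall>f :: 's \<Rightarrow> real. continuous_on S f \<and> bounded (f ` S) \<longrightarrow>
        (\<lambda>n. \<integral>s. f s \<partial>I n) \<longlonglongrightarrow> (\<integral>s. f s \<partial>J))"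

lemma borel_probsD:
  assumes "I \<in> borel_probs S"
  shows "prob_space I" "sets I = sets (restrict_space borel S)" "space I = S"
  using assms sets_eq_imp_space_eq[of I "restrict_space borel S"]
  by (auto simp: borel_probs_def space_restrict_space)

lemma measurable_borel_probs:
  "I \<in> borel_probs S \<Longrightarrow> measurable I N = measurable (restrict_space borel S) N"
  by (rule measurable_cong_sets) (simp_all add: borel_probsD)

lemma integrable_borel_probs:
  fixes f :: "'s::topological_space \<Rightarrow> real"
  assumes "I \<in> borel_probs S" "f \<in> borel_measurable (restrict_space borel S)"
    and "\<And>s. s \<in> S \<Longrightarrow> \<bar>f s\<bar> \<le> K"
  shows "integrable I f"
proof -
  interpret prob_space I using assms(1) by (rule borel_probsD)
  show ?thesis
    by (rule integrable_const_bound[where B = K])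
      (use assms in \<open>auto simp: measurable_borel_probs borel_probsD(3)\<close>)
qed

lemma integral_borel_probs_mono:
  fixes f g :: "'s::topological_space \<Rightarrow> real"
  assumes "I \<in> borel_probs S" "integrable I f" "integrable I g" "\<And>s. s \<in> S \<Longrightarrow> f s \<le> g s"
  shows "(\<integral>s. f s \<partial>I) \<le> (\<integral>s. g s \<partial>I)"
  by (rule integral_mono) (use assms in \<open>auto simp: borel_probsD(3)\<close>)

lemma integral_borel_probs_abs_le:
  fixes f :: "'s::topological_space \<Rightarrow> real"
  assumes I: "I \<in> borel_probs S" and "f \<in> borel_measurable (restrict_space borel S)"
    and "\<And>s. s \<in> S \<Longrightarrow> \<bar>f s\<bar> \<le> K"
  shows "\<bar>\<integral>s. f s \<partial>I\<bar> \<le> K"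
proof -
  interpret prob_space I using assms(1) by (rule borel_probsD)
  have int: "integrable I f" by (rule integrable_borel_probs) fact+
  have "(\<integral>s. f s \<partial>I) \<le> (\<integral>s. K \<partial>I)" "(\<integral>s. - K \<partial>I) \<le> (\<integral>s. f s \<partial>I)"
    by (rule integral_borel_probs_mono[OF I]; use int assms(3) in \<open>fastforce simp: abs_le_iff\<close>)+
  then show ?thesis by (simp add: prob_space)
qed

lemma dense_sequence:
  obtains c :: "nat \<Rightarrow> 'a::polish_space" where "\<And>x e. e > 0 \<Longrightarrow> \<exists>i. dist x (c i) < e"
proof -
  obtain D :: "'a set" where D: "countable D" "\<And>X. open X \<Longrightarrow> X \<noteq> {} \<Longrightarrow> \<exists>d\<in>D. d \<in> X"
    by (rule countable_dense_setE) blast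
  have "D \<noteq> {}" using D(2)[of UNIV] by auto
  then have range: "range (from_nat_into D) = D"
    using D(1) by (simp add: range_from_nat_into)
  have "\<exists>i. dist x (from_nat_into D i) < e" if "e > 0" for x e
    using D(2)[of "ball x e"] that range by (auto simp: mem_ball) (metis rangeE)
  then show thesis by (rule that)
qed

text \<open>The functions \<open>bump i v * bump_rest i v\<close> are a continuous partition of unity subordinate to the
  balls of radius \<open>2 * \<epsilon>\<close> around the \<open>c i\<close>, with remainder \<open>bump_rest N\<close> after \<open>N\<close> terms.\<close>

context
  fixes c :: "nat \<Rightarrow> 'h::real_inner" and \<epsilon> :: real
begin

definition bump :: "nat \<Rightarrow> 'h \<Rightarrow> real" where
  "bump i v = max 0 (min 1 (2 - norm (v - c i) / \<epsilon>))"

definition bump_rest :: "nat \<Rightarrow> 'h \<Rightarrow> real" where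
  "bump_rest N v = (\<Prod>j<N. 1 - bump j v)"

lemma bump_bounds: "0 \<le> bump i v" "bump i v \<le> 1"
  unfolding bump_def by auto

lemma bump_rest_bounds: "0 \<le> bump_rest N v" "bump_rest N v \<le> 1"
  unfolding bump_rest_def by (auto intro!: prod_nonneg prod_le_1 simp: bump_bounds)

lemma continuous_on_bump [continuous_intros]: "continuous_on A (bump i)"
  unfolding bump_def divide_inverse by (intro continuous_intros)

lemma continuous_on_bump_rest [continuous_intros]: "continuous_on A (bump_rest N)"
  unfolding bump_rest_def by (intro continuous_intros)

text \<open>Telescoping: each summand is \<open>bump_rest i v - bump_rest (Suc i) v\<close>.\<close>

lemma sum_bump: "(\<Sum>i<N. bump i v * bump_rest i v) = 1 - bump_rest N v"
  by (induction N) (auto simp: bump_rest_def algebra_simps)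

text \<open>The vector \<open>v\<close> is split with the same weights as the approximating sum. A
  weight is nonzero only if \<open>c i\<close> lies within \<open>2 * \<epsilon>\<close> of
  \<open>v\<close>, and the undistributed share \<open>bump_rest N v\<close> costs at most its
  multiple of \<open>norm v\<close>.\<close>

lemma bump_approximation:
  assumes "\<epsilon> > 0"
  shows "norm (v - (\<Sum>i<N. (bump i v * bump_rest i v) *\<^sub>R c i)) \<le> 2 * \<epsilon> + bump_rest N v * norm v"
proof -
  have "v - (\<Sum>i<N. (bump i v * bump_rest i v) *\<^sub>R c i) =
      bump_rest N v *\<^sub>R v + ((\<Sum>i<N. bump i v * bump_rest i v) *\<^sub>R v
        - (\<Sum>i<N. (bump i v * bump_rest i v) *\<^sub>R c i))"
    by (simp add: sum_bump algebra_simps)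
  also have "\<dots> = bump_rest N v *\<^sub>R v + (\<Sum>i<N. (bump i v * bump_rest i v) *\<^sub>R (v - c i))"
    by (simp add: scaleR_sum_left scaleR_diff_right sum_subtractf)
  also have "norm \<dots> \<le> bump_rest N v * norm v + (\<Sum>i<N. bump i v * bump_rest i v * (2 * \<epsilon>))"
  proof (rule order_trans[OF norm_triangle_ineq], rule add_mono)
    show "norm (bump_rest N v *\<^sub>R v) \<le> bump_rest N v * norm v"
      by (simp add: bump_rest_bounds)
    show "norm (\<Sum>i<N. (bump i v * bump_rest i v) *\<^sub>R (v - c i)) \<le> (\<Sum>i<N. bump i v * bump_rest i v * (2 * \<epsilon>))"
    proof (rule sum_norm_le)
      fix i
      have "bump i v = 0" if "norm (v - c i) > 2 * \<epsilon>"
        using assms that by (simp add: bump_def field_simps)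
      then consider "bump i v = 0" | "norm (v - c i) \<le> 2 * \<epsilon>"
        by (meson not_le)
      then show "norm ((bump i v * bump_rest i v) *\<^sub>R (v - c i)) \<le> bump i v * bump_rest i v * (2 * \<epsilon>)"
        by cases (auto simp: abs_mult bump_bounds bump_rest_bounds intro!: mult_left_mono)
    qed
  qed
  also have "(\<Sum>i<N. bump i v * bump_rest i v * (2 * \<epsilon>)) = (1 - bump_rest N v) * (2 * \<epsilon>)"
    by (simp add: sum_distrib_right[symmetric] sum_bump)
  also have "\<dots> \<le> 2 * \<epsilon>"
    using assms bump_rest_bounds[of N v] by (simp add: field_simps)
  finally show ?thesis by simp
qed

text \<open>A bump equals 1 near its centre, so the product defining the remainder contains a zero
  factor from some index on.\<close>

lemma bump_rest_tendsto_0: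
  assumes "\<epsilon> > 0" and "norm (v - c i) < \<epsilon>"
  shows "(\<lambda>N. bump_rest N v) \<longlonglongrightarrow> 0"
proof (rule tendsto_eventually)
  have "norm (v - c i) / \<epsilon> < 1" using assms by simp
  then have "bump i v = 1" unfolding bump_def by simp
  then have "bump_rest N v = 0" if "N > i" for N
    using that by (auto simp: bump_rest_def)
  then show "\<forall>\<^sub>F N in sequentially. bump_rest N v = 0"
    by (rule eventually_mono[OF eventually_gt_at_top[of i]])
qed

end

text \<open>This is norm convergence of the integrals of \<open>g\<close> in dual form.
  \<open>g\<close> is approximated by finite combinations of the \<open>c i\<close> whose weights
  are continuous and independent of \<open>h\<close>. The approximation error is governed by the
  integral of the remainder, itself a bounded continuous function, so weak convergence controls it
  under \<open>I n\<close> as well; this takes the place of a tightness argument.\<close>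

lemma weak_convergence_uniform_inner:
  fixes g :: "'s::topological_space \<Rightarrow> 'h::{real_inner, polish_space}"
  assumes I: "\<And>n. I n \<in> borel_probs S" and J: "J \<in> borel_probs S" and conv: "weakly_converges S I J"
    and g: "continuous_on S g" and K: "\<And>s. s \<in> S \<Longrightarrow> norm (g s) \<le> K" "0 \<le> K" and "e > 0"
  shows "\<forall>\<^sub>F n in sequentially. \<forall>h. \<bar>(\<integral>s. g s \<bullet> h \<partial>I n) - (\<integral>s. g s \<bullet> h \<partial>J)\<bar> \<le> e * norm h"
proof -
  \<comment> \<open>The errors add up to one \<open>\<epsilon>\<close> for the finite sum and
    \<open>2 * \<epsilon> + K * \<epsilon>\<close> for each of the two approximations, hence
    \<open>(5 + 2 * K) * \<epsilon>\<close>; the denominator leaves slack.\<close>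
  define \<epsilon> where "\<epsilon> = e / (5 + 3 * K)"
  have \<epsilon>: "\<epsilon> > 0" unfolding \<epsilon>_def using \<open>e > 0\<close> K(2) by simp
  obtain c :: "nat \<Rightarrow> 'h" where dense: "\<And>x e. e > 0 \<Longrightarrow> \<exists>i. dist x (c i) < e"
    by (rule dense_sequence) blast
  define q where "q N s = bump_rest c \<epsilon> N (g s)" for N s
  define \<phi> where "\<phi> i s = bump c \<epsilon> i (g s) * bump_rest c \<epsilon> i (g s)" for i s
  have contq: "continuous_on S (q N)" and cont\<phi>: "continuous_on S (\<phi> N)" for N
    unfolding q_def \<phi>_def
    by (intro continuous_intros continuous_on_compose2[OF continuous_on_bump_rest[of UNIV] g]
        continuous_on_compose2[OF continuous_on_bump[of UNIV] g] subset_UNIV)+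
  have q01: "\<bar>q N s\<bar> \<le> 1" and \<phi>01: "\<bar>\<phi> N s\<bar> \<le> 1" for N s
    unfolding q_def \<phi>_def using bump_bounds[of c \<epsilon>] bump_rest_bounds[of c \<epsilon>]
    by (auto simp: abs_mult intro: mult_le_one)
  note meas = borel_measurable_continuous_on_restrict
  have intq: "integrable I' (q N)" and int\<phi>: "integrable I' (\<phi> N)" if "I' \<in> borel_probs S" for I' N
    by (rule integrable_borel_probs[OF that _ q01] integrable_borel_probs[OF that _ \<phi>01],
        intro meas contq cont\<phi>)+
  have intg: "integrable I' (\<lambda>s. g s \<bullet> h)" if "I' \<in> borel_probs S" for I' h
  proof (rule integrable_borel_probs[OF that])
    show "(\<lambda>s. g s \<bullet> h) \<in> borel_measurable (restrict_space borel S)"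
      by (intro meas continuous_intros g)
    show "\<bar>g s \<bullet> h\<bar> \<le> K * norm h" if "s \<in> S" for s
      using Cauchy_Schwarz_ineq2[of "g s" h] K(1)[OF that] by (meson mult_right_mono norm_ge_zero order_trans)
  qed
  have approx: "\<bar>(\<integral>s. g s \<bullet> h \<partial>I') - (\<Sum>i<N. (c i \<bullet> h) * (\<integral>s. \<phi> i s \<partial>I'))\<bar>
      \<le> (2 * \<epsilon> + K * (\<integral>s. q N s \<partial>I')) * norm h" if I': "I' \<in> borel_probs S" for I' N h
  proof -
    interpret prob_space I' using I' by (rule borel_probsD)
    have "(\<integral>s. g s \<bullet> h \<partial>I') - (\<Sum>i<N. (c i \<bullet> h) * (\<integral>s. \<phi> i s \<partial>I')) =
      (\<integral>s. g s \<bullet> h - (\<Sum>i<N. (c i \<bullet> h) * \<phi> i s) \<partial>I')"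
      by (simp add: intg int\<phi> I')
    also have "\<bar>\<dots>\<bar> \<le> (\<integral>s. \<bar>g s \<bullet> h - (\<Sum>i<N. (c i \<bullet> h) * \<phi> i s)\<bar> \<partial>I')"
      by (rule integral_abs_bound)
    also have "\<dots> \<le> (\<integral>s. (2 * \<epsilon> + K * q N s) * norm h \<partial>I')"
    proof (rule integral_borel_probs_mono[OF I'])
      fix s assume s: "s \<in> S"
      have "g s \<bullet> h - (\<Sum>i<N. (c i \<bullet> h) * \<phi> i s) = (g s - (\<Sum>i<N. \<phi> i s *\<^sub>R c i)) \<bullet> h"
        by (simp add: inner_diff_left inner_sum_left mult.commute)
      also have "\<bar>\<dots>\<bar> \<le> norm (g s - (\<Sum>i<N. \<phi> i s *\<^sub>R c i)) * norm h"
        by (rule Cauchy_Schwarz_ineq2)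
      also have "\<dots> \<le> (2 * \<epsilon> + q N s * norm (g s)) * norm h"
        unfolding \<phi>_def q_def by (intro mult_right_mono bump_approximation \<epsilon>) simp
      also have "\<dots> \<le> (2 * \<epsilon> + K * q N s) * norm h"
        using K(1)[OF s] bump_rest_bounds[of c \<epsilon> N "g s"]
        by (auto simp: q_def mult.commute intro!: mult_right_mono mult_left_mono)
      finally show "\<bar>g s \<bullet> h - (\<Sum>i<N. (c i \<bullet> h) * \<phi> i s)\<bar> \<le> (2 * \<epsilon> + K * q N s) * norm h" .
    qed (use intg int\<phi> intq I' in auto)
    also have "\<dots> = (2 * \<epsilon> + K * (\<integral>s. q N s \<partial>I')) * norm h"
      using intq[OF I'] by (simp add: prob_space)
    finally show ?thesis .
  qed
  have "(\<lambda>N. \<integral>s. q N s \<partial>J) \<longlonglongrightarrow> (\<integral>s. 0 \<partial>J)"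
  proof (rule integral_dominated_convergence[where w = "\<lambda>_. 1"])
    interpret prob_space J using J by (rule borel_probsD)
    show "integrable J (\<lambda>_. 1 :: real)" by simp
    show "q N \<in> borel_measurable J" for N using intq[OF J] by auto
    show "AE s in J. (\<lambda>N. q N s) \<longlonglongrightarrow> 0"
      unfolding q_def
    proof (rule AE_I2)
      fix s
      obtain i where "dist (g s) (c i) < \<epsilon>" using dense[OF \<epsilon>] by blast
      then show "(\<lambda>N. bump_rest c \<epsilon> N (g s)) \<longlonglongrightarrow> 0"
        by (intro bump_rest_tendsto_0[OF \<epsilon>]) (simp add: dist_norm)
    qed
  qed (use q01 in auto)
  \<comment> \<open>The truncation \<open>N\<close> is fixed by looking at \<open>J\<close> alone;
    only afterwards does \<open>n\<close> vary.\<close>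
  then have "\<forall>\<^sub>F N in sequentially. (\<integral>s. q N s \<partial>J) < \<epsilon>"
    using \<epsilon> by (auto dest: order_tendstoD)
  then obtain N where N: "(\<integral>s. q N s \<partial>J) < \<epsilon>"
    by (auto simp: eventually_sequentially)
  have conv': "(\<lambda>n. \<integral>s. f s \<partial>I n) \<longlonglongrightarrow> (\<integral>s. f s \<partial>J)"
    if "continuous_on S f" "\<And>s. \<bar>f s\<bar> \<le> 1" for f :: "'s \<Rightarrow> real"
  proof -
    have "bounded (f ` S)" using that(2) by (intro boundedI[of _ 1]) auto
    then show ?thesis using conv that(1) unfolding weakly_converges_def by blast
  qed
  \<comment> \<open>The remainder \<open>q N\<close> is a test function for weak convergence, so its
    mass is small under \<open>I n\<close> too.\<close>
  have "\<forall>\<^sub>F n in sequentially. (\<integral>s. q N s \<partial>I n) < \<epsilon>"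
    using conv'[OF contq q01] N by (auto dest: order_tendstoD)
  moreover have "(\<lambda>n. \<Sum>i<N. norm (c i) * \<bar>(\<integral>s. \<phi> i s \<partial>I n) - (\<integral>s. \<phi> i s \<partial>J)\<bar>) \<longlonglongrightarrow>
      (\<Sum>i<N. norm (c i) * \<bar>(\<integral>s. \<phi> i s \<partial>J) - (\<integral>s. \<phi> i s \<partial>J)\<bar>)"
    by (intro tendsto_intros conv'[OF cont\<phi> \<phi>01])
  then have "\<forall>\<^sub>F n in sequentially.
      (\<Sum>i<N. norm (c i) * \<bar>(\<integral>s. \<phi> i s \<partial>I n) - (\<integral>s. \<phi> i s \<partial>J)\<bar>) < \<epsilon>"
    using \<epsilon> by (auto dest: order_tendstoD)
  ultimately show ?thesis
  proof eventually_elim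
    case (elim n)
    show ?case
    proof
      fix h
      let ?A = "\<lambda>I'. \<Sum>i<N. (c i \<bullet> h) * (\<integral>s. \<phi> i s \<partial>I')"
      have "?A (I n) - ?A J = (\<Sum>i<N. (c i \<bullet> h) * ((\<integral>s. \<phi> i s \<partial>I n) - (\<integral>s. \<phi> i s \<partial>J)))"
        by (simp add: sum_subtractf right_diff_distrib)
      also have "\<bar>\<dots>\<bar> \<le> (\<Sum>i<N. (norm (c i) * \<bar>(\<integral>s. \<phi> i s \<partial>I n) - (\<integral>s. \<phi> i s \<partial>J)\<bar>) * norm h)"
      proof (rule order_trans[OF sum_abs], rule sum_mono)
        fix i
        show "\<bar>(c i \<bullet> h) * ((\<integral>s. \<phi> i s \<partial>I n) - (\<integral>s. \<phi> i s \<partial>J))\<bar>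
            \<le> (norm (c i) * \<bar>(\<integral>s. \<phi> i s \<partial>I n) - (\<integral>s. \<phi> i s \<partial>J)\<bar>) * norm h"
          using mult_right_mono[OF Cauchy_Schwarz_ineq2[of "c i" h],
              of "\<bar>(\<integral>s. \<phi> i s \<partial>I n) - (\<integral>s. \<phi> i s \<partial>J)\<bar>"]
          by (simp add: abs_mult mult_ac)
      qed
      also have "\<dots> \<le> \<epsilon> * norm h"
        unfolding sum_distrib_right[symmetric] using elim(2) by (simp add: mult_right_mono)
      finally have 1: "\<bar>?A (I n) - ?A J\<bar> \<le> \<epsilon> * norm h" .
      have K\<epsilon>: "(2 * \<epsilon> + K * x) * norm h \<le> (2 * \<epsilon> + K * \<epsilon>) * norm h" if "x < \<epsilon>" for x
        using that K(2) by (auto intro!: mult_right_mono mult_left_mono)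
      have 2: "\<bar>(\<integral>s. g s \<bullet> h \<partial>I n) - ?A (I n)\<bar> \<le> (2 * \<epsilon> + K * \<epsilon>) * norm h"
        using order_trans[OF approx[OF I] K\<epsilon>[OF elim(1)]] .
      have 3: "\<bar>(\<integral>s. g s \<bullet> h \<partial>J) - ?A J\<bar> \<le> (2 * \<epsilon> + K * \<epsilon>) * norm h"
        using order_trans[OF approx[OF J] K\<epsilon>[OF N]] .
      have "\<bar>(\<integral>s. g s \<bullet> h \<partial>I n) - (\<integral>s. g s \<bullet> h \<partial>J)\<bar>
          \<le> \<epsilon> * norm h + 2 * ((2 * \<epsilon> + K * \<epsilon>) * norm h)"
        using 1 2 3 by linarith
      also have "\<dots> = ((5 + 2 * K) * \<epsilon>) * norm h" by (simp add: algebra_simps)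
      also have "\<dots> \<le> ((5 + 3 * K) * \<epsilon>) * norm h"
        using K(2) \<epsilon> by (intro mult_right_mono) auto
      also have "(5 + 3 * K) * \<epsilon> = e"
        unfolding \<epsilon>_def using K(2) by simp
      finally show "\<bar>(\<integral>s. g s \<bullet> h \<partial>I n) - (\<integral>s. g s \<bullet> h \<partial>J)\<bar> \<le> e * norm h" .
    qed
  qed
qed


section \<open>Regularized risk minimization\<close>

text \<open>Points \<open>s\<close> are observations and the second argument of \<open>F\<close> is
  an element of the RKHS. Convexity and differentiability enter only as a subgradient inequality
  together with continuity of \<open>G\<close> in both arguments. A bound on \<open>F\<close> is
  required at 0 alone, as the bound on \<open>G\<close> makes \<open>F\<close> Lipschitz in
  \<open>f\<close>.\<close>

locale smooth_convex_risk =
  fixes S :: "'s::topological_space set"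
    and F :: "'s \<Rightarrow> 'h::{real_inner, polish_space} \<Rightarrow> real"
    and G :: "'s \<Rightarrow> 'h \<Rightarrow> 'h"
    and B C :: real
  assumes F_measurable: "\<And>f. (\<lambda>s. F s f) \<in> borel_measurable (restrict_space borel S)"
    and F_nonneg: "\<And>s f. s \<in> S \<Longrightarrow> 0 \<le> F s f"
    and F_zero_le: "\<And>s. s \<in> S \<Longrightarrow> F s 0 \<le> B"
    and subgradient: "\<And>s f h. s \<in> S \<Longrightarrow> F s f + G s f \<bullet> (h - f) \<le> F s h"
    and G_bound: "\<And>s f. s \<in> S \<Longrightarrow> norm (G s f) \<le> C"
    and C_nonneg: "0 \<le> C"
    and G_continuous_fst: "\<And>f. continuous_on S (\<lambda>s. G s f)"
    and G_continuous_snd: "\<And>s. s \<in> S \<Longrightarrow> continuous_on UNIV (G s)"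
begin

lemma G_inner_bound: "s \<in> S \<Longrightarrow> \<bar>G s f \<bullet> h\<bar> \<le> C * norm h"
  using Cauchy_Schwarz_ineq2[of "G s f" h] G_bound[of s f]
  by (meson mult_right_mono norm_ge_zero order_trans)

lemma F_Lipschitz:
  assumes "s \<in> S"
  shows "\<bar>F s f - F s h\<bar> \<le> C * norm (f - h)"
  using subgradient[OF assms, of f h] subgradient[OF assms, of h f]
    G_inner_bound[OF assms, of f "h - f"] G_inner_bound[OF assms, of h "f - h"]
  by (simp add: norm_minus_commute)

lemma F_bound: "s \<in> S \<Longrightarrow> \<bar>F s f\<bar> \<le> B + C * norm f"
  using F_Lipschitz[of s f 0] F_nonneg[of s f] F_zero_le[of s] by simp

text \<open>\<open>F\<close> itself is merely measurable in \<open>s\<close>; its increments are uniform limits of Riemann sums of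
  the gradient.\<close>

lemma F_increment_continuous: "continuous_on S (\<lambda>s. F s f - F s 0)"
proof -
  define R where "R m s = (\<Sum>i<m. G s ((real i / real m) *\<^sub>R f) \<bullet> f / real m)" for m s
  have error: "\<bar>R m s - (F s f - F s 0)\<bar> \<le> 2 * C * norm f / real m" if s: "s \<in> S" and m: "m > 0" for m s
  proof -
    define p where "p i = (real i / real m) *\<^sub>R f" for i :: nat
    define r where "r i = G s (p i) \<bullet> f / real m" for i
    have p0: "p 0 = 0" and pm: "p m = f" using m by (auto simp: p_def)
    have step: "p (Suc i) - p i = f /\<^sub>R real m" for i
      by (simp add: p_def scaleR_diff_left[symmetric] diff_divide_distrib[symmetric] inverse_eq_divide)
    have lower: "r i \<le> F s (p (Suc i)) - F s (p i)" for i
      using subgradient[OF s, of "p i" "p (Suc i)"]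
      unfolding step r_def by (simp add: divide_inverse mult.commute)
    have step': "p i - p (Suc i) = - (f /\<^sub>R real m)" for i
      using step[of i] by (metis minus_diff_eq)
    have upper: "F s (p (Suc i)) - F s (p i) \<le> r (Suc i)" for i
      using subgradient[OF s, of "p (Suc i)" "p i"]
      unfolding step' r_def by (simp add: divide_inverse mult.commute)
    have telescope: "(\<Sum>i<m. F s (p (Suc i)) - F s (p i)) = F s f - F s 0"
      using sum_lessThan_telescope[of "\<lambda>i. F s (p i)" m] by (simp add: p0 pm)
    have "R m s = (\<Sum>i<m. r i)" unfolding R_def r_def p_def ..
    moreover have "(\<Sum>i<m. r i) \<le> F s f - F s 0"
      unfolding telescope[symmetric] by (rule sum_mono) (rule lower)
    moreover have "F s f - F s 0 \<le> (\<Sum>i<m. r (Suc i))"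
      unfolding telescope[symmetric] by (rule sum_mono) (rule upper)
    \<comment> \<open>Left and right Riemann sums enclose the increment by the subgradient
      inequality, and they differ only in their end terms, which gives a rate uniform in
      \<open>s\<close>.\<close>
    moreover have "(\<Sum>i<m. r (Suc i)) - (\<Sum>i<m. r i) = r m - r 0"
      using sum_lessThan_telescope[of r m] by (simp add: sum_subtractf)
    moreover have r_bound: "\<bar>r i\<bar> \<le> C * norm f / real m" for i
      unfolding r_def abs_divide using G_inner_bound[OF s] m by (simp add: divide_right_mono)
    have "r m - r 0 \<le> 2 * C * norm f / real m"
    proof -
      have "2 * C * norm f / real m = C * norm f / real m + C * norm f / real m" by simp
      then show ?thesis using r_bound[of m] r_bound[of 0] by linarith
    qed
    ultimately show ?thesis by linarith
  qed
  have "uniform_limit S R (\<lambda>s. F s f - F s 0) sequentially"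
  proof (rule uniform_limitI)
    fix e :: real assume e: "e > 0"
    have "(\<lambda>m. 2 * C * norm f / real m) \<longlonglongrightarrow> 0"
      by (rule lim_const_over_n)
    then have "\<forall>\<^sub>F m in sequentially. 2 * C * norm f / real m < e"
      using e by (rule order_tendstoD)
    with eventually_gt_at_top[of 0]
    show "\<forall>\<^sub>F m in sequentially. \<forall>s\<in>S. dist (R m s) (F s f - F s 0) < e"
    proof eventually_elim
      case (elim m)
      then show ?case using error[of _ m] by (auto simp: dist_real_def intro: order_le_less_trans)
    qed
  qed
  then show ?thesis
  proof (rule uniform_limit_theorem[rotated])
    show "\<forall>\<^sub>F m in sequentially. continuous_on S (R m)"
      unfolding R_def divide_inverse by (intro always_eventually allI continuous_intros G_continuous_fst)
  qed simp
qed

section \<open>Risk functionals and their regularized minimizers\<close>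

definition erisk :: "'s measure \<Rightarrow> 'h \<Rightarrow> real" where
  "erisk I f = (\<integral>s. F s f \<partial>I)"

lemma F_integrable: "I \<in> borel_probs S \<Longrightarrow> integrable I (\<lambda>s. F s f)"
  by (rule integrable_borel_probs[OF _ F_measurable F_bound])

lemma G_inner_measurable: "(\<lambda>s. G s f \<bullet> h) \<in> borel_measurable (restrict_space borel S)"
  by (intro borel_measurable_continuous_on_restrict continuous_intros G_continuous_fst)

lemma G_inner_integrable: "I \<in> borel_probs S \<Longrightarrow> integrable I (\<lambda>s. G s f \<bullet> h)"
  by (rule integrable_borel_probs[OF _ G_inner_measurable G_inner_bound])

lemma erisk_nonneg: "I \<in> borel_probs S \<Longrightarrow> 0 \<le> erisk I f"
  unfolding erisk_def by (rule integral_nonneg_AE) (auto simp: borel_probsD F_nonneg)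

lemma erisk_subgradient:
  assumes I: "I \<in> borel_probs S"
  shows "erisk I f + (\<integral>s. G s f \<bullet> (h - f) \<partial>I) \<le> erisk I h"
  unfolding erisk_def
  using integral_borel_probs_mono[OF I, of "\<lambda>s. F s f + G s f \<bullet> (h - f)" "\<lambda>s. F s h"]
    F_integrable[OF I] G_inner_integrable[OF I] subgradient by simp

lemma erisk_Lipschitz:
  assumes I: "I \<in> borel_probs S"
  shows "\<bar>erisk I f - erisk I h\<bar> \<le> C * norm (f - h)"
proof -
  have "erisk I f - erisk I h = (\<integral>s. F s f - F s h \<partial>I)"
    unfolding erisk_def by (simp add: F_integrable[OF I])
  also have "\<bar>\<dots>\<bar> \<le> C * norm (f - h)"
    by (rule integral_borel_probs_abs_le[OF I _ F_Lipschitz]) (intro borel_measurable_diff F_measurable)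
  finally show ?thesis .
qed

text \<open>The subgradient inequality is applied at the midpoint towards both ends; the two linear
  terms are opposite and cancel on averaging.\<close>

lemma erisk_midpoint:
  assumes I: "I \<in> borel_probs S"
  shows "erisk I ((f + h) /\<^sub>R 2) \<le> (erisk I f + erisk I h) / 2"
proof -
  let ?m = "(f + h) /\<^sub>R 2"
  have eq: "f - ?m = (1/2) *\<^sub>R (f - h)" "h - ?m = - ((1/2) *\<^sub>R (f - h))"
    by (simp_all add: scaleR_diff_right scaleR_add_right scaleR_half_double algebra_simps
        flip: scaleR_add_left)
  show ?thesis
    using erisk_subgradient[OF I, of ?m f] erisk_subgradient[OF I, of ?m h] unfolding eq by simp
qed

lemma erisk_continuous:
  assumes I: "I \<in> borel_probs S"
  shows "continuous_on UNIV (erisk I)"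
proof (rule continuous_onI)
  fix f :: 'h and e :: real assume e: "e > 0"
  show "\<exists>d>0. \<forall>h\<in>UNIV. dist h f < d \<longrightarrow> dist (erisk I h) (erisk I f) \<le> e"
  \<comment> \<open>Dividing by \<open>C + 1\<close> instead of \<open>C\<close> also covers
    \<open>C = 0\<close>.\<close>
  proof (intro exI[of _ "e / (C + 1)"] conjI ballI impI)
    show "e / (C + 1) > 0" using e C_nonneg by simp
    fix h assume "dist h f < e / (C + 1)"
    then have "(C + 1) * norm (h - f) < e"
      using C_nonneg by (simp add: dist_norm field_simps)
    moreover have "C * norm (h - f) \<le> (C + 1) * norm (h - f)" by (simp add: distrib_right)
    ultimately show "dist (erisk I h) (erisk I f) \<le> e"
      using erisk_Lipschitz[OF I, of h f] by (simp add: dist_real_def)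
  qed
qed

definition objective :: "'s measure \<Rightarrow> real \<Rightarrow> 'h \<Rightarrow> real" where
  "objective I lam f = erisk I f + lam * (norm f)\<^sup>2"

text \<open>The chosen property is quadratic growth rather than mere minimality: it carries
  uniqueness and turns near-minimal values into norm estimates.\<close>

definition minimizer :: "'s measure \<Rightarrow> real \<Rightarrow> 'h" where
  "minimizer I lam =
     (SOME p. \<forall>f. objective I lam p + lam / 2 * (norm (f - p))\<^sup>2 \<le> objective I lam f)"

lemma objective_ge_minimizer:
  assumes I: "I \<in> borel_probs S" and lam: "lam > 0"
  shows "objective I lam (minimizer I lam) + lam / 2 * (norm (f - minimizer I lam))\<^sup>2 \<le> objective I lam f"
proof -
  have "continuous_on UNIV (objective I lam)"
    unfolding objective_def by (intro continuous_intros erisk_continuous I)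
  moreover have "0 \<le> objective I lam f" for f
    unfolding objective_def using erisk_nonneg[OF I] lam by simp
  moreover have "objective I lam ((f + h) /\<^sub>R 2) \<le>
      (objective I lam f + objective I lam h) / 2 - lam / 4 * (norm (f - h))\<^sup>2" for f h
    using erisk_midpoint[OF I, of f h]
    unfolding objective_def norm_midpoint_sq by (simp add: field_simps)
  ultimately obtain p
    where "\<And>f. objective I lam p + lam / 2 * (norm (f - p))\<^sup>2 \<le> objective I lam f"
    using strongly_convex_minimizer lam by blast
  then have "\<forall>f. objective I lam (minimizer I lam) + lam / 2 * (norm (f - minimizer I lam))\<^sup>2
      \<le> objective I lam f"
    unfolding minimizer_def by (intro someI) blast
  then show ?thesis ..
qed

lemma objective_minimizer_le:
  assumes "I \<in> borel_probs S" "lam > 0"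
  shows "objective I lam (minimizer I lam) \<le> objective I lam f"
proof -
  have "0 \<le> lam / 2 * (norm (f - minimizer I lam))\<^sup>2" using assms(2) by simp
  then show ?thesis using objective_ge_minimizer[OF assms, of f] by linarith
qed

text \<open>No derivative of the risk is taken. Minimality of \<open>p\<close> against
  \<open>p + t n *\<^sub>R h\<close> is combined with the subgradient inequality at the displaced
  point; after division by \<open>t n\<close>, continuity of \<open>G\<close> in \<open>f\<close>
  and dominated convergence move the gradient back to \<open>p\<close>.\<close>

lemma minimizer_first_order:
  assumes I: "I \<in> borel_probs S" and lam: "lam > 0"
  defines "p \<equiv> minimizer I lam"
  shows "0 \<le> (\<integral>s. G s p \<bullet> h \<partial>I) + 2 * lam * (p \<bullet> h)"
proof -
  interpret prob_space I using I by (rule borel_probsD)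
  define t where "t n = 1 / real (Suc n)" for n
  have t: "t n > 0" for n by (simp add: t_def)
  have t_lim: "t \<longlonglongrightarrow> 0"
    unfolding t_def using LIMSEQ_inverse_real_of_nat by (simp add: inverse_eq_divide)
  have "0 \<le> (\<integral>s. G s (p + t n *\<^sub>R h) \<bullet> h \<partial>I) + (2 * lam * (p \<bullet> h) + lam * t n * (norm h)\<^sup>2)" for n
  proof -
    have "objective I lam p \<le> objective I lam (p + t n *\<^sub>R h)"
      unfolding p_def by (rule objective_minimizer_le[OF I lam])
    moreover have "(norm (p + t n *\<^sub>R h))\<^sup>2 = (norm p)\<^sup>2 + t n * (2 * (p \<bullet> h) + t n * (norm h)\<^sup>2)"
      unfolding power2_norm_eq_inner
      by (simp add: inner_add_left inner_add_right inner_commute algebra_simps)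
    moreover have "erisk I (p + t n *\<^sub>R h) - t n * (\<integral>s. G s (p + t n *\<^sub>R h) \<bullet> h \<partial>I) \<le> erisk I p"
      using erisk_subgradient[OF I, of "p + t n *\<^sub>R h" p] by simp
    ultimately have "0 \<le> t n * ((\<integral>s. G s (p + t n *\<^sub>R h) \<bullet> h \<partial>I) + (2 * lam * (p \<bullet> h) + lam * t n * (norm h)\<^sup>2))"
      unfolding objective_def by (simp add: algebra_simps)
    then show ?thesis using t[of n] by (simp add: zero_le_mult_iff)
  qed
  moreover have "(\<lambda>n. (\<integral>s. G s (p + t n *\<^sub>R h) \<bullet> h \<partial>I) + (2 * lam * (p \<bullet> h) + lam * t n * (norm h)\<^sup>2))
      \<longlonglongrightarrow> (\<integral>s. G s p \<bullet> h \<partial>I) + (2 * lam * (p \<bullet> h) + lam * 0 * (norm h)\<^sup>2)"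
  proof (intro tendsto_add tendsto_mult tendsto_const t_lim
      integral_dominated_convergence[where w = "\<lambda>_. C * norm h"])
    show "AE s in I. (\<lambda>n. G s (p + t n *\<^sub>R h) \<bullet> h) \<longlonglongrightarrow> G s p \<bullet> h"
    proof (rule AE_I2)
      fix s assume "s \<in> space I"
      then have s: "s \<in> S" using borel_probsD(3)[OF I] by simp
      have "(\<lambda>n. p + t n *\<^sub>R h) \<longlonglongrightarrow> p + 0 *\<^sub>R h"
        by (intro tendsto_intros t_lim)
      then have "(\<lambda>n. G s (p + t n *\<^sub>R h)) \<longlonglongrightarrow> G s p"
        using continuous_on_tendsto_compose[OF G_continuous_snd[OF s]] by simp
      then show "(\<lambda>n. G s (p + t n *\<^sub>R h) \<bullet> h) \<longlonglongrightarrow> G s p \<bullet> h"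
        by (intro tendsto_intros)
    qed
    show "AE s in I. norm (G s (p + t n *\<^sub>R h) \<bullet> h) \<le> C * norm h" for n
      using G_inner_bound by (auto simp: borel_probsD(3)[OF I])
  qed (use G_inner_measurable measurable_borel_probs[OF I] in auto)
  ultimately show ?thesis
    by (auto dest!: LIMSEQ_le_const intro: exI[of _ 0])
qed

lemma minimizer_weakly_continuous:
  assumes I: "\<And>n. I n \<in> borel_probs S" and J: "J \<in> borel_probs S"
    and conv: "weakly_converges S I J" and lam: "lam > 0"
  shows "(\<lambda>n. minimizer (I n) lam) \<longlonglongrightarrow> minimizer J lam"
proof (rule LIMSEQ_I)
  fix r :: real assume r: "r > 0"
  define p where "p = minimizer J lam"
  \<comment> \<open>Uniformity in \<open>h\<close> is essential, since the bound is applied to the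
    displacement of the minimizers, which varies with \<open>n\<close>. The tolerance
    \<open>lam * r / 2\<close> yields a displacement of at most \<open>r / 2\<close>.\<close>
  have "\<forall>\<^sub>F n in sequentially.
      \<forall>h. \<bar>(\<integral>s. G s p \<bullet> h \<partial>I n) - (\<integral>s. G s p \<bullet> h \<partial>J)\<bar> \<le> (lam * r / 2) * norm h"
    by (rule weak_convergence_uniform_inner[OF I J conv G_continuous_fst G_bound C_nonneg])
      (use lam r in auto)
  then have "\<forall>\<^sub>F n in sequentially. norm (minimizer (I n) lam - p) < r"
  proof eventually_elim
    case (elim n)
    define h where "h = minimizer (I n) lam - p"
    have p_n: "minimizer (I n) lam = p + h" by (simp add: h_def)
    have "objective (I n) lam (p + h) \<le> objective (I n) lam p"
      unfolding p_n[symmetric] by (rule objective_minimizer_le[OF I lam])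
    moreover have "(norm (p + h))\<^sup>2 = (norm p)\<^sup>2 + 2 * (p \<bullet> h) + (norm h)\<^sup>2"
      unfolding power2_norm_eq_inner by (simp add: inner_add_left inner_add_right inner_commute)
    ultimately have "erisk (I n) (p + h) + lam * (2 * (p \<bullet> h) + (norm h)\<^sup>2) \<le> erisk (I n) p"
      unfolding objective_def by (simp add: algebra_simps)
    moreover have "erisk (I n) p + (\<integral>s. G s p \<bullet> h \<partial>I n) \<le> erisk (I n) (p + h)"
      using erisk_subgradient[OF I, of n p "p + h"] by simp
    moreover have "0 \<le> (\<integral>s. G s p \<bullet> h \<partial>J) + 2 * lam * (p \<bullet> h)"
      unfolding p_def by (rule minimizer_first_order[OF J lam])
    moreover have "(\<integral>s. G s p \<bullet> h \<partial>J) - (\<integral>s. G s p \<bullet> h \<partial>I n) \<le> (lam * r / 2) * norm h"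
      using elim[rule_format, of h] by linarith
    moreover have "lam * (2 * (p \<bullet> h) + (norm h)\<^sup>2) = 2 * lam * (p \<bullet> h) + lam * (norm h)\<^sup>2"
      by (simp add: algebra_simps)
    ultimately have "lam * (norm h)\<^sup>2 \<le> (lam * r / 2) * norm h"
      by linarith
    then have "lam * norm h * norm h \<le> lam * (r / 2) * norm h"
      by (simp add: power2_eq_square)
    then have "norm h \<le> r / 2 \<or> norm h = 0"
      using lam by (auto simp: mult_le_cancel_right)
    then show "norm (minimizer (I n) lam - p) < r"
      using r unfolding h_def by auto
  qed
  then show "\<exists>N. \<forall>n\<ge>N. norm (minimizer (I n) lam - minimizer J lam) < r"
    unfolding p_def eventually_sequentially .
qed

lemma erisk_minimizer_weakly_continuous:
  assumes "\<And>n. I n \<in> borel_probs S" "J \<in> borel_probs S" "weakly_converges S I J" "lam > 0"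
  shows "(\<lambda>n. erisk J (minimizer (I n) lam)) \<longlonglongrightarrow> erisk J (minimizer J lam)"
  using continuous_on_tendsto_compose[OF erisk_continuous[OF assms(2)] minimizer_weakly_continuous[OF assms]]
  by simp

definition inf_risk :: "'s measure \<Rightarrow> real" where
  "inf_risk I = (INF f. erisk I f)"

lemma bdd_below_erisk: "I \<in> borel_probs S \<Longrightarrow> bdd_below (range (erisk I))"
  by (rule bdd_belowI2[of _ 0]) (rule erisk_nonneg)

lemma inf_risk_le: "I \<in> borel_probs S \<Longrightarrow> inf_risk I \<le> erisk I f"
  unfolding inf_risk_def by (rule cINF_lower[OF bdd_below_erisk]) auto

text \<open>Any \<open>f\<close> with risk below \<open>a\<close> is a competitor whose penalty
  vanishes with \<open>lam k\<close>.\<close>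

lemma erisk_minimizer_tendsto_inf_risk:
  assumes J: "J \<in> borel_probs S" and lam: "\<And>k. lam k > 0" "lam \<longlonglongrightarrow> 0"
  shows "(\<lambda>k. erisk J (minimizer J (lam k))) \<longlonglongrightarrow> inf_risk J"
proof (rule order_tendstoI)
  fix a assume "a < inf_risk J"
  then show "\<forall>\<^sub>F k in sequentially. a < erisk J (minimizer J (lam k))"
    using inf_risk_le[OF J] by (intro always_eventually allI) (meson less_le_trans)
next
  fix a assume "inf_risk J < a"
  then obtain f where f: "erisk J f < a"
    unfolding inf_risk_def using cInf_less_iff[OF _ bdd_below_erisk[OF J]] by auto
  have "(\<lambda>k. erisk J f + lam k * (norm f)\<^sup>2) \<longlonglongrightarrow> erisk J f + 0 * (norm f)\<^sup>2"
    by (intro tendsto_intros lam)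
  then have "\<forall>\<^sub>F k in sequentially. erisk J f + lam k * (norm f)\<^sup>2 < a"
    using f by (auto dest: order_tendstoD)
  then show "\<forall>\<^sub>F k in sequentially. erisk J (minimizer J (lam k)) < a"
  proof eventually_elim
    case (elim k)
    have "0 \<le> lam k * (norm (minimizer J (lam k)))\<^sup>2" using lam(1)[of k] by simp
    then show ?case
      using elim objective_minimizer_le[OF J lam(1), of k f] unfolding objective_def by linarith
  qed
qed

end


section \<open>Convergence in probability\<close>

text \<open>\<open>\<kappa> n\<close> is the largest \<open>k \<le> n\<close> with
  \<open>N k \<le> n\<close>. The restriction \<open>k \<le> n\<close> makes the set finite, and the
  inserted 0 makes it nonempty; \<open>N\<close> may be arbitrary.\<close>

lemma slow_index:
  fixes N :: "nat \<Rightarrow> nat"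
  obtains \<kappa> where "filterlim \<kappa> at_top sequentially" and "\<forall>\<^sub>F n in sequentially. N (\<kappa> n) \<le> n"
proof -
  define \<kappa> where "\<kappa> n = Max (insert 0 {k. k \<le> n \<and> N k \<le> n})" for n
  have fin: "finite (insert 0 {k. k \<le> n \<and> N k \<le> n})" for n by simp
  have "k \<le> \<kappa> n" if "n \<ge> max k (N k)" for n k
    unfolding \<kappa>_def by (rule Max_ge[OF fin]) (use that in auto)
  then have "\<forall>\<^sub>F n in sequentially. k \<le> \<kappa> n" for k
    unfolding eventually_sequentially by blast
  then have "filterlim \<kappa> at_top sequentially"
    by (simp add: filterlim_at_top)
  moreover have "N (\<kappa> n) \<le> n" if "n \<ge> N 0" for n
    using Max_in[OF fin[of n]] that unfolding \<kappa>_def[symmetric] by auto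
  then have "\<forall>\<^sub>F n in sequentially. N (\<kappa> n) \<le> n"
    unfolding eventually_sequentially by blast
  ultimately show thesis by (rule that)
qed

context prob_space
begin

text \<open>The tail events decrease to a null set, so continuity from above applies. Controlling
  all later indices at once is what the almost sure case requires.\<close>

lemma AE_tendsto_imp_tail_prob:
  fixes X :: "nat \<Rightarrow> 'a \<Rightarrow> real"
  assumes [measurable]: "\<And>n. X n \<in> borel_measurable M"
    and lim: "AE w in M. (\<lambda>n. X n w) \<longlonglongrightarrow> 0" and e: "e > 0"
  shows "(\<lambda>n. prob {w \<in> space M. \<exists>m\<ge>n. X m w > e}) \<longlonglongrightarrow> 0"
proof -
  define A where "A n = {w \<in> space M. \<exists>m\<ge>n. X m w > e}" for n
  have A: "range A \<subseteq> events" unfolding A_def by auto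
  have "decseq A"
    unfolding A_def decseq_def by (auto intro: order_trans)
  then have "(\<lambda>n. prob (A n)) \<longlonglongrightarrow> prob (\<Inter>n. A n)"
    by (rule finite_Lim_measure_decseq[OF A])
  moreover have "AE w in M. w \<notin> (\<Inter>n. A n)"
    using lim
  proof eventually_elim
    case (elim w)
    then have "\<forall>\<^sub>F n in sequentially. X n w < e"
      using e by (rule order_tendstoD)
    then obtain n where "\<forall>m\<ge>n. X m w < e" by (auto simp: eventually_sequentially)
    then have "w \<notin> A n" unfolding A_def by (auto simp: not_less intro: less_imp_le)
    then show ?case by blast
  qed
  then have "prob (\<Inter>n. A n) = 0"
    using A by (subst prob_eq_0) (auto intro: sets.countable_INT)
  ultimately show ?thesis unfolding A_def by simp
qed

lemma AE_tendsto_imp_prob: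
  fixes X :: "nat \<Rightarrow> 'a \<Rightarrow> real"
  assumes [measurable]: "\<And>n. X n \<in> borel_measurable M"
    and "AE w in M. (\<lambda>n. X n w) \<longlonglongrightarrow> 0" and "e > 0"
  shows "(\<lambda>n. prob {w \<in> space M. X n w > e}) \<longlonglongrightarrow> 0"
proof (rule tendsto_sandwich[OF _ _ tendsto_const AE_tendsto_imp_tail_prob[OF assms]])
  show "\<forall>\<^sub>F n in sequentially. prob {w \<in> space M. X n w > e} \<le> prob {w \<in> space M. \<exists>m\<ge>n. X m w > e}"
    by (intro always_eventually allI finite_measure_mono) auto
qed auto

lemma borel_cantelli_geometric:
  assumes "\<And>k. A k \<in> events" "\<And>k. prob (A k) \<le> (1/2) ^ k"
  shows "AE w in M. \<forall>\<^sub>F k in sequentially. w \<notin> A k"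
proof -
  have "summable (\<lambda>k. prob (A k))"
    by (rule summable_comparison_test'[of "\<lambda>k. (1/2) ^ k" 0]) (use assms(2) in \<open>auto intro: summable_geometric\<close>)
  then have "AE w in M. \<forall>\<^sub>F k in sequentially. w \<in> space M - A k"
    using assms(1) by (intro borel_cantelli_AE1) (auto simp: emeasure_eq_measure)
  then show ?thesis by (auto elim: eventually_mono)
qed

lemma tendsto_prob_imp_AE_subseq:
  fixes X :: "nat \<Rightarrow> 'a \<Rightarrow> real"
  assumes [measurable]: "\<And>n. X n \<in> borel_measurable M" and nonneg: "\<And>n w. 0 \<le> X n w"
    and lim: "\<And>e. e > 0 \<Longrightarrow> (\<lambda>n. prob {w \<in> space M. X n w > e}) \<longlonglongrightarrow> 0"
  obtains r where "strict_mono r" "AE w in M. (\<lambda>n. X (r n) w) \<longlonglongrightarrow> 0"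
proof -
  have "\<exists>N. \<forall>n\<ge>N. prob {w \<in> space M. X n w > 1 / real (Suc k)} < (1/2) ^ k" for k
    using order_tendstoD(2)[OF lim, of "1 / real (Suc k)" "(1/2) ^ k"]
    by (auto simp: eventually_sequentially)
  then obtain N where N: "\<And>k n. n \<ge> N k \<Longrightarrow> prob {w \<in> space M. X n w > 1 / real (Suc k)} < (1/2) ^ k"
    by metis
  \<comment> \<open>The sum makes \<open>r\<close> dominate every \<open>N k\<close> without
    monotonicity of \<open>N\<close>, and the summand \<open>k\<close> makes it strictly
    increasing.\<close>
  define r where "r k = k + (\<Sum>i\<le>k. N i)" for k
  have "strict_mono r" by (rule strict_mono_Suc_iff[THEN iffD2]) (simp add: r_def)
  moreover have "N k \<le> r k" for k
    unfolding r_def by (rule trans_le_add2) (rule member_le_sum, auto)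
  then have "AE w in M. \<forall>\<^sub>F k in sequentially. w \<notin> {w \<in> space M. X (r k) w > 1 / real (Suc k)}"
    using N by (intro borel_cantelli_geometric) (auto intro: less_imp_le)
  then have "AE w in M. (\<lambda>n. X (r n) w) \<longlonglongrightarrow> 0"
    using AE_space
  proof eventually_elim
    case (elim w)
    show ?case
    proof (rule tendsto_sandwich[OF _ _ tendsto_const])
      show "(\<lambda>k. 1 / real (Suc k)) \<longlonglongrightarrow> 0"
        using LIMSEQ_inverse_real_of_nat by (simp add: inverse_eq_divide)
      show "\<forall>\<^sub>F k in sequentially. X (r k) w \<le> 1 / real (Suc k)"
        using elim by (auto elim: eventually_mono simp: not_less)
    qed (simp add: nonneg)
  qed
  ultimately show thesis by (rule that)
qed

text \<open>If the probabilities stayed above some \<open>\<delta>\<close> along a subsequence, the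
  further subsequence converging almost surely would contradict this.\<close>

lemma subseq_AE_imp_tendsto_prob:
  fixes X :: "nat \<Rightarrow> 'a \<Rightarrow> real"
  assumes [measurable]: "\<And>n. X n \<in> borel_measurable M"
    and sub: "\<And>r :: nat \<Rightarrow> nat. strict_mono r \<Longrightarrow> \<exists>r'. strict_mono r' \<and> (AE w in M. (\<lambda>n. X (r (r' n)) w) \<longlonglongrightarrow> 0)"
    and e: "e > 0"
  shows "(\<lambda>n. prob {w \<in> space M. X n w > e}) \<longlonglongrightarrow> 0"
proof (rule ccontr)
  assume "\<not> ?thesis"
  then obtain \<delta> where \<delta>: "\<delta> > 0" and "\<not> (\<forall>\<^sub>F n in sequentially. prob {w \<in> space M. X n w > e} < \<delta>)"
    by (auto simp: tendsto_iff)
  then have "\<exists>\<^sub>F n in sequentially. prob {w \<in> space M. X n w > e} \<ge> \<delta>"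
    by (simp add: not_eventually not_less)
  then have "infinite {n. prob {w \<in> space M. X n w > e} \<ge> \<delta>}"
    unfolding cofinite_eq_sequentially[symmetric] frequently_cofinite .
  from infinite_enumerate[OF this] obtain r :: "nat \<Rightarrow> nat"
    where r: "strict_mono r" "\<And>n. prob {w \<in> space M. X (r n) w > e} \<ge> \<delta>"
    by auto
  obtain r' where "AE w in M. (\<lambda>n. X (r (r' n)) w) \<longlonglongrightarrow> 0"
    using sub[OF r(1)] by blast
  then have "(\<lambda>n. prob {w \<in> space M. X (r (r' n)) w > e}) \<longlonglongrightarrow> 0"
    by (intro AE_tendsto_imp_prob e) auto
  then have "\<forall>\<^sub>F n in sequentially. prob {w \<in> space M. X (r (r' n)) w > e} < \<delta>"
    using \<delta> by (rule order_tendstoD)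
  then show False using r(2) by (auto simp: eventually_sequentially not_less[symmetric])
qed

end

text \<open>Measurability is demanded only against bounded continuous test functions. A
  \<open>random_measure\<close> provides this, and for empirical measures the integrals are finite
  averages.\<close>

definition random_probs ::
  "'w measure \<Rightarrow> 's::topological_space set \<Rightarrow> ('w \<Rightarrow> 's measure) \<Rightarrow> bool" where
  "random_probs M S \<mu> \<longleftrightarrow> (\<forall>w\<in>space M. \<mu> w \<in> borel_probs S) \<and>
     (\<forall>f :: 's \<Rightarrow> real. continuous_on S f \<and> bounded (f ` S) \<longrightarrow>
        (\<lambda>w. \<integral>s. f s \<partial>\<mu> w) \<in> borel_measurable M)"

lemma random_probs_borel_probs: "random_probs M S \<mu> \<Longrightarrow> w \<in> space M \<Longrightarrow> \<mu> w \<in> borel_probs S"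
  by (simp add: random_probs_def)

section \<open>Measurable dependence of regularized minimizers on random measures\<close>

context smooth_convex_risk
begin

text \<open>Subtracting the risk at 0 replaces the integrand by an increment of \<open>F\<close>,
  which is bounded and continuous in \<open>s\<close> and hence an admissible test function for
  \<open>random_probs\<close>.\<close>

definition excess :: "'s measure \<Rightarrow> 'h \<Rightarrow> real" where
  "excess I f = erisk I f - erisk I 0"

lemma excess_measurable:
  assumes "random_probs M S \<mu>"
  shows "(\<lambda>w. excess (\<mu> w) f) \<in> borel_measurable M"
proof -
  have "\<bar>F s f - F s 0\<bar> \<le> C * norm f" if "s \<in> S" for s
    using F_Lipschitz[OF that, of f 0] by simp
  then have "bounded ((\<lambda>s. F s f - F s 0) ` S)"
    by (intro boundedI[of _ "C * norm f"]) auto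
  then have "(\<lambda>w. \<integral>s. F s f - F s 0 \<partial>\<mu> w) \<in> borel_measurable M"
    using assms F_increment_continuous unfolding random_probs_def by blast
  moreover have "excess (\<mu> w) f = (\<integral>s. F s f - F s 0 \<partial>\<mu> w)" if "w \<in> space M" for w
    using F_integrable[OF random_probs_borel_probs[OF assms that]] unfolding excess_def erisk_def by simp
  ultimately show ?thesis by (subst measurable_cong) auto
qed

lemma objective_excess: "objective I lam f = excess I f + lam * (norm f)\<^sup>2 + erisk I 0"
  unfolding objective_def excess_def by simp

text \<open>The minimizer is the limit of near-minimizers taken from a dense sequence; selecting the first
  of them makes the choice measurable.\<close>

lemma excess_minimizer_measurable:
  assumes \<mu>: "random_probs M S \<mu>" and J: "random_probs M S J" and lam: "lam > 0"
  shows "(\<lambda>w. excess (J w) (minimizer (\<mu> w) lam)) \<in> borel_measurable M"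
proof -
  obtain c :: "nat \<Rightarrow> 'h" where dense: "\<And>x e. e > 0 \<Longrightarrow> \<exists>i. dist x (c i) < e"
    by (rule dense_sequence) blast
  \<comment> \<open>This is the objective up to the term \<open>erisk (\<mu> w) 0\<close>, which
    does not depend on \<open>i\<close> and so does not affect comparisons, but might fail to be
    measurable.\<close>
  define ob where "ob w i = excess (\<mu> w) (c i) + lam * (norm (c i))\<^sup>2" for w i
  have ob_measurable [measurable]: "(\<lambda>w. ob w i) \<in> borel_measurable M" for i
    unfolding ob_def using excess_measurable[OF \<mu>] by simp
  define near where "near k i w \<longleftrightarrow> (\<forall>j. ob w i \<le> ob w j + 1 / real (Suc k))" for k i w
  define sel where "sel k w = (LEAST i. near k i w)" for k w
  have [measurable]: "Measurable.pred M (near k i)" for k i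
    unfolding near_def by measurable
  have sel_measurable: "sel k \<in> measurable M (count_space UNIV)" for k
    unfolding sel_def by measurable
  have "(\<lambda>w. excess (J w) (c (sel k w))) \<in> borel_measurable M" for k
    by (rule measurable_compose_countable[OF excess_measurable[OF J] sel_measurable])
  moreover have "(\<lambda>k. excess (J w) (c (sel k w))) \<longlonglongrightarrow> excess (J w) (minimizer (\<mu> w) lam)"
    if w: "w \<in> space M" for w
  proof -
    note \<mu>w = random_probs_borel_probs[OF \<mu> w] and Jw = random_probs_borel_probs[OF J w]
    define p where "p = minimizer (\<mu> w) lam"
    define E where "E = objective (\<mu> w) lam"
    have E_ob: "E (c i) = ob w i + erisk (\<mu> w) 0" for i
      unfolding E_def ob_def objective_excess by simp
    have "continuous_on UNIV E"
      unfolding E_def objective_def by (intro continuous_intros erisk_continuous \<mu>w)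
    then have E_dense: "\<exists>i. E (c i) < E p + e" if "e > 0" for e
    proof -
      obtain d where d: "d > 0" "\<And>f. dist f p < d \<Longrightarrow> dist (E f) (E p) < e"
        using \<open>continuous_on UNIV E\<close> \<open>e > 0\<close> unfolding continuous_on_iff by blast
      obtain i where "dist p (c i) < d" using dense[OF d(1)] by blast
      then have "E (c i) < E p + e"
        using d(2)[of "c i"] by (simp add: dist_commute dist_real_def abs_less_iff)
      then show ?thesis ..
    qed
    have p_min: "E p + lam / 2 * (norm (f - p))\<^sup>2 \<le> E f" for f
      unfolding E_def p_def by (rule objective_ge_minimizer[OF \<mu>w lam])
    have p_le: "E p \<le> E f" for f
      unfolding E_def p_def by (rule objective_minimizer_le[OF \<mu>w lam])
    have sel_near: "near k (sel k w) w" for k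
    proof -
      obtain i where "E (c i) < E p + 1 / real (Suc k)" using E_dense[of "1 / real (Suc k)"] by auto
      then have "near k i w"
        using p_le[of "c j" for j] unfolding near_def E_ob by (smt (verit))
      then show ?thesis unfolding sel_def by (rule LeastI)
    qed
    \<comment> \<open>Near-minimality was tested only against the \<open>c i\<close>; density and
      continuity extend it to the true minimum.\<close>
    have E_sel: "E (c (sel k w)) \<le> E p + 1 / real (Suc k)" for k
    proof (rule field_le_epsilon)
      fix e :: real assume "e > 0"
      then obtain i where "E (c i) < E p + e" using E_dense by blast
      moreover have "ob w (sel k w) \<le> ob w i + 1 / real (Suc k)"
        using sel_near unfolding near_def by blast
      ultimately show "E (c (sel k w)) \<le> E p + 1 / real (Suc k) + e" unfolding E_ob by linarith
    qed
    \<comment> \<open>Quadratic growth at \<open>p\<close> turns the excess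
      \<open>1 / real (Suc k)\<close> into a bound on the squared distance.\<close>
    have "(\<lambda>k. (norm (c (sel k w) - p))\<^sup>2) \<longlonglongrightarrow> 0"
    proof (rule tendsto_sandwich[OF _ _ tendsto_const])
      have "(\<lambda>k. 2 / lam * inverse (real (Suc k))) \<longlonglongrightarrow> 2 / lam * 0"
        by (intro tendsto_mult tendsto_const LIMSEQ_inverse_real_of_nat)
      then show "(\<lambda>k. 2 / lam * inverse (real (Suc k))) \<longlonglongrightarrow> 0" by simp
      show "\<forall>\<^sub>F k in sequentially. (norm (c (sel k w) - p))\<^sup>2 \<le> 2 / lam * inverse (real (Suc k))"
      proof (intro always_eventually allI)
        fix k
        have "lam / 2 * (norm (c (sel k w) - p))\<^sup>2 \<le> inverse (real (Suc k))"
          using p_min[of "c (sel k w)"] E_sel[of k] by (simp add: inverse_eq_divide)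
        then have "2 / lam * (lam / 2 * (norm (c (sel k w) - p))\<^sup>2) \<le> 2 / lam * inverse (real (Suc k))"
          using lam by (intro mult_left_mono) auto
        then show "(norm (c (sel k w) - p))\<^sup>2 \<le> 2 / lam * inverse (real (Suc k))" using lam by simp
      qed
    qed auto
    from tendsto_real_sqrt[OF this] have "(\<lambda>k. c (sel k w)) \<longlonglongrightarrow> p"
      by (simp add: tendsto_norm_zero_iff LIM_zero_iff)
    then have "(\<lambda>k. erisk (J w) (c (sel k w))) \<longlonglongrightarrow> erisk (J w) p"
      using continuous_on_tendsto_compose[OF erisk_continuous[OF Jw]] by simp
    then show ?thesis unfolding excess_def p_def by (intro tendsto_intros)
  qed
  ultimately show ?thesis by (rule borel_measurable_LIMSEQ_real[rotated])
qed

end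


section \<open>Consistency\<close>

text \<open>A countable grid of regularization parameters; the final sequence moves along it slowly.
  The same numbers also serve as tolerances for errors and probabilities.\<close>

definition reg :: "nat \<Rightarrow> real" where
  "reg k = inverse (real (Suc k))"

lemma reg_pos [simp]: "0 < reg k"
  by (simp add: reg_def)

lemma reg_tendsto_0: "reg \<longlonglongrightarrow> 0"
  unfolding reg_def by (rule LIMSEQ_inverse_real_of_nat)

context smooth_convex_risk
begin

lemma excess_minimizer_tendsto:
  assumes "J \<in> borel_probs S"
  shows "(\<lambda>k. excess J (minimizer J (reg k))) \<longlonglongrightarrow> inf_risk J - erisk J 0"
  unfolding excess_def
  by (intro tendsto_diff tendsto_const erisk_minimizer_tendsto_inf_risk assms reg_tendsto_0) simp

text \<open>The infimum over the whole RKHS is uncountable; the minimizers for \<open>reg k\<close>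
  represent it as the limit of a sequence of measurable functions.\<close>

lemma inf_excess_measurable:
  assumes "random_probs M S J"
  shows "(\<lambda>w. inf_risk (J w) - erisk (J w) 0) \<in> borel_measurable M"
  by (rule borel_measurable_LIMSEQ_real[OF excess_minimizer_tendsto[OF random_probs_borel_probs[OF assms]]])
    (simp_all add: excess_minimizer_measurable[OF assms assms])

definition suboptimality :: "'s measure \<Rightarrow> 's measure \<Rightarrow> real \<Rightarrow> real" where
  "suboptimality I J lam = erisk J (minimizer I lam) - inf_risk J"

lemma suboptimality_nonneg: "J \<in> borel_probs S \<Longrightarrow> 0 \<le> suboptimality I J lam"
  unfolding suboptimality_def using inf_risk_le[of J "minimizer I lam"] by simp

lemma suboptimality_measurable:
  assumes "random_probs M S \<mu>" "random_probs M S J" "lam > 0"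
  shows "(\<lambda>w. suboptimality (\<mu> w) (J w) lam) \<in> borel_measurable M"
proof -
  have "suboptimality (\<mu> w) (J w) lam =
      excess (J w) (minimizer (\<mu> w) lam) - (inf_risk (J w) - erisk (J w) 0)" for w
    unfolding suboptimality_def excess_def by simp
  then show ?thesis
    using excess_minimizer_measurable[OF assms] inf_excess_measurable[OF assms(2)] by simp
qed

end

text \<open>\<open>D\<close> stands for the distance of \<open>\<mu> n\<close> to \<open>J\<close>.
  \<open>D_weak\<close> speaks of arbitrary index maps \<open>r\<close>, so that it also applies
  along subsequences on which \<open>D\<close> converges at the given sample point.\<close>

locale converging_risk = smooth_convex_risk S F G B C + prob_space M
  for S :: "'s::topological_space set"
    and F :: "'s \<Rightarrow> 'h::{real_inner, polish_space} \<Rightarrow> real" and G B C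
    and M :: "'w measure" +
  fixes \<mu> :: "nat \<Rightarrow> 'w \<Rightarrow> 's measure" and J :: "'w \<Rightarrow> 's measure" and D :: "nat \<Rightarrow> 'w \<Rightarrow> real"
  assumes \<mu>: "\<And>n. random_probs M S (\<mu> n)" and J: "random_probs M S J"
    and D_weak: "\<And>r w. w \<in> space M \<Longrightarrow> (\<lambda>n. D (r n) w) \<longlonglongrightarrow> 0 \<Longrightarrow>
      weakly_converges S (\<lambda>n. \<mu> (r n) w) (J w)"
begin

text \<open>The error caused by minimizing under \<open>\<mu> n\<close> instead of \<open>J\<close>
  at a fixed parameter \<open>reg k\<close>. The infimum cancels; it is kept because each
  \<open>suboptimality\<close> is known to be measurable.\<close>

definition gap :: "nat \<Rightarrow> nat \<Rightarrow> 'w \<Rightarrow> real" where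
  "gap k n w = \<bar>suboptimality (\<mu> n w) (J w) (reg k) - suboptimality (J w) (J w) (reg k)\<bar>"

lemma gap_measurable [measurable]: "gap k n \<in> borel_measurable M"
  unfolding gap_def using suboptimality_measurable[OF \<mu> J] suboptimality_measurable[OF J J] by simp

lemma regularization_measurable [measurable]:
  "(\<lambda>w. suboptimality (J w) (J w) (reg k)) \<in> borel_measurable M"
  using suboptimality_measurable[OF J J] by simp

lemma gap_tendsto_0:
  assumes "w \<in> space M" "(\<lambda>n. D (r n) w) \<longlonglongrightarrow> 0"
  shows "(\<lambda>n. gap k (r n) w) \<longlonglongrightarrow> 0"
proof -
  have "(\<lambda>n. erisk (J w) (minimizer (\<mu> (r n) w) (reg k))) \<longlonglongrightarrow> erisk (J w) (minimizer (J w) (reg k))"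
    using assms by (intro erisk_minimizer_weakly_continuous D_weak)
      (auto intro: random_probs_borel_probs[OF \<mu>] random_probs_borel_probs[OF J])
  then show ?thesis
    unfolding gap_def suboptimality_def
    by (intro tendsto_rabs_zero) (simp add: LIM_zero_iff)
qed

lemma regularization_tendsto_0:
  assumes "w \<in> space M"
  shows "(\<lambda>k. suboptimality (J w) (J w) (reg k)) \<longlonglongrightarrow> 0"
  unfolding suboptimality_def LIM_zero_iff
  by (intro erisk_minimizer_tendsto_inf_risk random_probs_borel_probs[OF J assms] reg_tendsto_0) simp

lemma suboptimality_le_gap:
  "suboptimality (\<mu> n w) (J w) (reg k) \<le> gap k n w + suboptimality (J w) (J w) (reg k)"
  unfolding gap_def by simp

text \<open>\<open>D_weak\<close> is a pathwise statement, so for fixed \<open>k\<close> convergence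
  of \<open>gap k\<close> in probability is obtained from almost sure convergence along
  subsequences. The slow index then balances this error against that of regularization.\<close>

theorem consistent_in_prob:
  assumes D_measurable: "\<And>n. D n \<in> borel_measurable M" and D_nonneg: "\<And>n w. 0 \<le> D n w"
    and D_lim: "\<And>e. e > 0 \<Longrightarrow> (\<lambda>n. prob {w \<in> space M. D n w > e}) \<longlonglongrightarrow> 0"
  obtains \<kappa> where "filterlim \<kappa> at_top sequentially"
    "\<forall>e>0. (\<lambda>n. prob {w \<in> space M. suboptimality (\<mu> n w) (J w) (reg (\<kappa> n)) > e}) \<longlonglongrightarrow> 0"
proof -
  have gap_lim: "(\<lambda>n. prob {w \<in> space M. gap k n w > e}) \<longlonglongrightarrow> 0" if "e > 0" for k e
  proof (rule subseq_AE_imp_tendsto_prob[OF gap_measurable _ that])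
    fix r :: "nat \<Rightarrow> nat" assume r: "strict_mono r"
    have "(\<lambda>n. prob {w \<in> space M. D (r n) w > e}) \<longlonglongrightarrow> 0" if "e > 0" for e
      using LIMSEQ_subseq_LIMSEQ[OF D_lim[OF that] r] by (simp add: comp_def)
    then obtain r' where r': "strict_mono r'" "AE w in M. (\<lambda>n. D (r (r' n)) w) \<longlonglongrightarrow> 0"
      using tendsto_prob_imp_AE_subseq[of "\<lambda>n. D (r n)", OF D_measurable D_nonneg] by blast
    from r'(2) AE_space have "AE w in M. (\<lambda>n. gap k (r (r' n)) w) \<longlonglongrightarrow> 0"
      by eventually_elim (rule gap_tendsto_0)
    with r'(1) show "\<exists>r'. strict_mono r' \<and> (AE w in M. (\<lambda>n. gap k (r (r' n)) w) \<longlonglongrightarrow> 0)" by blast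
  qed
  have "\<exists>N. \<forall>n\<ge>N. prob {w \<in> space M. gap k n w > reg k} < reg k" for k
    using order_tendstoD(2)[OF gap_lim, of "reg k" "reg k" k] by (auto simp: eventually_sequentially)
  then obtain N where N: "\<And>k n. n \<ge> N k \<Longrightarrow> prob {w \<in> space M. gap k n w > reg k} < reg k"
    by metis
  obtain \<kappa> where \<kappa>: "filterlim \<kappa> at_top sequentially" and N_\<kappa>: "\<forall>\<^sub>F n in sequentially. N (\<kappa> n) \<le> n"
    by (rule slow_index)
  have "(\<lambda>n. prob {w \<in> space M. suboptimality (\<mu> n w) (J w) (reg (\<kappa> n)) > e}) \<longlonglongrightarrow> 0" if e: "e > 0" for e
  proof (rule tendsto_sandwich[OF _ _ tendsto_const])
    have reg_\<kappa>: "(\<lambda>n. reg (\<kappa> n)) \<longlonglongrightarrow> 0"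
      by (rule filterlim_compose[OF reg_tendsto_0 \<kappa>])
    have "(\<lambda>k. prob {w \<in> space M. suboptimality (J w) (J w) (reg k) > e / 2}) \<longlonglongrightarrow> 0"
      by (intro AE_tendsto_imp_prob AE_I2 regularization_tendsto_0 regularization_measurable) (use e in auto)
    from tendsto_add[OF reg_\<kappa> filterlim_compose[OF this \<kappa>]]
    show "(\<lambda>n. reg (\<kappa> n) + prob {w \<in> space M. suboptimality (J w) (J w) (reg (\<kappa> n)) > e / 2}) \<longlonglongrightarrow> 0"
      by simp
    \<comment> \<open>Half of \<open>e\<close> is allotted to the gap, which is at most
      \<open>reg (\<kappa> n)\<close> off a set of probability below
      \<open>reg (\<kappa> n)\<close>, and half to the regularization error.\<close>
    have "\<forall>\<^sub>F n in sequentially. reg (\<kappa> n) < e / 2"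
      by (rule order_tendstoD(2)[OF reg_\<kappa>]) (use e in simp)
    with N_\<kappa> show "\<forall>\<^sub>F n in sequentially.
        prob {w \<in> space M. suboptimality (\<mu> n w) (J w) (reg (\<kappa> n)) > e}
        \<le> reg (\<kappa> n) + prob {w \<in> space M. suboptimality (J w) (J w) (reg (\<kappa> n)) > e / 2}"
    proof eventually_elim
      case (elim n)
      let ?A = "{w \<in> space M. gap (\<kappa> n) n w > reg (\<kappa> n)}"
        and ?B = "{w \<in> space M. suboptimality (J w) (J w) (reg (\<kappa> n)) > e / 2}"
      have "prob {w \<in> space M. suboptimality (\<mu> n w) (J w) (reg (\<kappa> n)) > e} \<le> prob (?A \<union> ?B)"
      proof (rule finite_measure_mono)
        show "{w \<in> space M. suboptimality (\<mu> n w) (J w) (reg (\<kappa> n)) > e} \<subseteq> ?A \<union> ?B"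
          using suboptimality_le_gap[of n _ "\<kappa> n"] elim(2) by (auto simp: not_less) (smt (verit) field_sum_of_halves)
      qed measurable
      also have "\<dots> \<le> prob ?A + prob ?B" by (rule measure_Un_le) measurable
      also have "\<dots> \<le> reg (\<kappa> n) + prob ?B" using N[OF elim(1)] by simp
      finally show ?case .
    qed
  qed simp
  then show thesis by (intro that[OF \<kappa>] allI impI)
qed

text \<open>A deterministic \<open>\<kappa>\<close> must suit almost every sample point.
  \<open>N k\<close> is chosen so that the event of any gap above \<open>reg k\<close> from
  \<open>N k\<close> on has probability at most \<open>(1/2) ^ k\<close>; by Borel-Cantelli almost
  every point lies in finitely many of these events.\<close>

theorem consistent_AE:
  assumes D_lim: "AE w in M. (\<lambda>n. D n w) \<longlonglongrightarrow> 0"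
  obtains \<kappa> where "filterlim \<kappa> at_top sequentially"
    "AE w in M. (\<lambda>n. suboptimality (\<mu> n w) (J w) (reg (\<kappa> n))) \<longlonglongrightarrow> 0"
proof -
  have gap_lim: "AE w in M. (\<lambda>n. gap k n w) \<longlonglongrightarrow> 0" for k
    using D_lim AE_space by eventually_elim (rule gap_tendsto_0[where r = "\<lambda>n. n"])
  define A where "A k n = {w \<in> space M. \<exists>m\<ge>n. gap k m w > reg k}" for k n
  have "(\<lambda>n. prob (A k n)) \<longlonglongrightarrow> 0" for k
    unfolding A_def by (rule AE_tendsto_imp_tail_prob[OF gap_measurable gap_lim]) simp
  then have "\<exists>n. prob (A k n) \<le> (1/2) ^ k" for k
    using order_tendstoD(2)[of _ 0 sequentially "(1/2) ^ k :: real"]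
    by (fastforce simp: eventually_sequentially intro: less_imp_le)
  then obtain N where N: "\<And>k. prob (A k (N k)) \<le> (1/2) ^ k" by metis
  have A_lim: "AE w in M. \<forall>\<^sub>F k in sequentially. w \<notin> A k (N k)"
    by (rule borel_cantelli_geometric[OF _ N]) (simp add: A_def)
  obtain \<kappa> where \<kappa>: "filterlim \<kappa> at_top sequentially" and N_\<kappa>: "\<forall>\<^sub>F n in sequentially. N (\<kappa> n) \<le> n"
    by (rule slow_index)
  from A_lim AE_space have "AE w in M. (\<lambda>n. suboptimality (\<mu> n w) (J w) (reg (\<kappa> n))) \<longlonglongrightarrow> 0"
  proof eventually_elim
    case (elim w)
    show ?case
    proof (rule tendsto_sandwich[OF _ _ tendsto_const])
      show "\<forall>\<^sub>F n in sequentially. 0 \<le> suboptimality (\<mu> n w) (J w) (reg (\<kappa> n))"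
        by (intro always_eventually allI suboptimality_nonneg random_probs_borel_probs[OF J elim(2)])
      have "(\<lambda>k. reg k + suboptimality (J w) (J w) (reg k)) \<longlonglongrightarrow> 0 + 0"
        by (intro tendsto_add reg_tendsto_0 regularization_tendsto_0 elim(2))
      from filterlim_compose[OF this \<kappa>]
      show "(\<lambda>n. reg (\<kappa> n) + suboptimality (J w) (J w) (reg (\<kappa> n))) \<longlonglongrightarrow> 0" by simp
      \<comment> \<open>Since \<open>N (\<kappa> n) \<le> n\<close>, the index \<open>n\<close> is
        among those controlled by the tail event.\<close>
      have "\<forall>\<^sub>F n in sequentially. w \<notin> A (\<kappa> n) (N (\<kappa> n))"
        using \<kappa> elim(1) by (rule eventually_compose_filterlim[rotated])
      with N_\<kappa> show "\<forall>\<^sub>F n in sequentially.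
          suboptimality (\<mu> n w) (J w) (reg (\<kappa> n)) \<le> reg (\<kappa> n) + suboptimality (J w) (J w) (reg (\<kappa> n))"
      proof eventually_elim
        case (elim n)
        then have "gap (\<kappa> n) n w \<le> reg (\<kappa> n)"
          using \<open>w \<in> space M\<close> unfolding A_def by (auto simp: not_less)
        then show ?case using suboptimality_le_gap[of n w "\<kappa> n"] by linarith
      qed
    qed
  qed
  with \<kappa> show thesis by (rule that)
qed

end


section \<open>Random and empirical measures\<close>

text \<open>Richness holds only almost surely, so the consistency error agrees with a measurable
  function only off a null set; completeness of the probability space transfers
  measurability.\<close>

lemma (in complete_measure) measurable_AE_cong:
  assumes f: "f \<in> borel_measurable M" and eq: "AE x in M. f x = g x"
  shows "g \<in> borel_measurable M"
proof (rule borel_measurableI)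
  fix U :: "'b set" assume "open U"
  show "g -` U \<inter> space M \<in> sets M"
  proof (rule in_sets_AE)
    show "f -` U \<inter> space M \<in> sets M"
      using f \<open>open U\<close> by (simp add: measurable_sets)
    show "AE x in M. x \<in> f -` U \<inter> space M \<longleftrightarrow> x \<in> g -` U \<inter> space M"
      using eq by eventually_elim auto
  qed auto
qed

text \<open>The zero test function with the open set \<open>UNIV\<close> makes the whole of
  \<open>borel_probs S\<close> a generator.\<close>

lemma topspace_weak_topology: "topspace (weak_topology S) = borel_probs S"
proof -
  have "(\<integral>z. (\<lambda>_. 0 :: real) z \<partial>\<mu>) \<in> UNIV" for \<mu> :: "'a measure" by simp
  moreover have "continuous_on S (\<lambda>_. 0 :: real)" "bounded ((\<lambda>_. 0 :: real) ` S)" "open (UNIV :: real set)"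
    by (auto intro!: boundedI[of _ 0])
  ultimately have "borel_probs S \<in> {{\<mu> \<in> borel_probs S. (\<integral>z. f z \<partial>\<mu>) \<in> U} | (f :: 'a \<Rightarrow> real) U.
        continuous_on S f \<and> bounded (f ` S) \<and> open U}"
    by (intro CollectI exI[of _ "\<lambda>_. 0 :: real"] exI[of _ "UNIV :: real set"]) auto
  then show ?thesis unfolding weak_topology_def topology_generated_by_topspace by blast
qed

lemma openin_weak_topology:
  fixes f :: "'a::topological_space \<Rightarrow> real"
  assumes "continuous_on S f" "bounded (f ` S)" "open U"
  shows "openin (weak_topology S) {\<mu> \<in> borel_probs S. (\<integral>z. f z \<partial>\<mu>) \<in> U}"
  unfolding weak_topology_def by (rule topology_generated_by_Basis) (use assms in blast)

lemma random_measure_imp_random_probs: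
  fixes S :: "'a::topological_space set"
  assumes "random_measure M S J"
  shows "random_probs M S J"
proof -
  have space: "space (borel_of (weak_topology S)) = borel_probs S"
    by (simp add: borel_of_def space_measure_of_conv topspace_weak_topology)
  have open_sets: "A \<in> sets (borel_of T)" if "openin T A" for T and A :: "'a measure set"
    unfolding borel_of_def using that openin_subset by (subst sets_measure_of) auto
  have J: "J \<in> measurable M (borel_of (weak_topology S))"
    using assms by (simp add: random_measure_def)
  have J_in: "J w \<in> borel_probs S" if "w \<in> space M" for w
    using measurable_space[OF J that] space by simp
  have "(\<lambda>w. \<integral>s. f s \<partial>J w) \<in> borel_measurable M" if "continuous_on S f" "bounded (f ` S)" for f :: "'a \<Rightarrow> real"
  proof (rule borel_measurableI)
    fix U :: "real set" assume "open U"
    have "(\<lambda>w. \<integral>s. f s \<partial>J w) -` U \<inter> space M = J -` {\<mu> \<in> borel_probs S. (\<integral>z. f z \<partial>\<mu>) \<in> U} \<inter> space M"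
      using J_in by auto
    also have "\<dots> \<in> sets M"
      by (intro measurable_sets[OF J] open_sets openin_weak_topology that \<open>open U\<close>)
    finally show "(\<lambda>w. \<integral>s. f s \<partial>J w) -` U \<inter> space M \<in> sets M" .
  qed
  with J_in show ?thesis unfolding random_probs_def by blast
qed

lemma metrizes_imp_weakly_converges:
  assumes d: "metrizes_weak_convergence S d" and I: "\<And>n. I n \<in> borel_probs S" and J: "J \<in> borel_probs S"
    and lim: "(\<lambda>n. d (I n) J) \<longlonglongrightarrow> 0"
  shows "weakly_converges S I J"
  unfolding weakly_converges_def
proof (intro allI impI)
  fix f :: "'a \<Rightarrow> real" assume f: "continuous_on S f \<and> bounded (f ` S)"
  interpret Metric_space "borel_probs S" d using d by (simp add: metrizes_weak_convergence_def)
  have "limitin (weak_topology S) I J sequentially"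
    using limitin_metric_dist_null[of I J sequentially] I J lim d by (simp add: metrizes_weak_convergence_def)
  then have *: "\<forall>\<^sub>F n in sequentially. I n \<in> A" if "openin (weak_topology S) A" "J \<in> A" for A
    using that by (simp add: limitin_def)
  show "(\<lambda>n. \<integral>s. f s \<partial>I n) \<longlonglongrightarrow> (\<integral>s. f s \<partial>J)"
  proof (rule topological_tendstoI)
    fix U :: "real set" assume "open U" "(\<integral>s. f s \<partial>J) \<in> U"
    then have "\<forall>\<^sub>F n in sequentially. I n \<in> {\<mu> \<in> borel_probs S. (\<integral>z. f z \<partial>\<mu>) \<in> U}"
      using f J by (intro * openin_weak_topology) auto
    then show "\<forall>\<^sub>F n in sequentially. (\<integral>s. f s \<partial>I n) \<in> U"
      by (rule eventually_mono) simp
  qed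
qed

lemma measurable_uniform_count_measure:
  "z \<in> A \<rightarrow> S \<Longrightarrow> z \<in> measurable (uniform_count_measure A) (restrict_space borel S)"
  by (rule measurableI)
    (auto simp: space_uniform_count_measure sets_uniform_count_measure space_restrict_space)

text \<open>As the image of the uniform distribution on the indices, the empirical measure is a
  probability measure with integrals that are averages. This needs \<open>n \<ge> 1\<close>.\<close>

lemma empirical_measure_eq_distr:
  assumes n: "n \<ge> 1" and z: "z \<in> {1..n} \<rightarrow> S"
  shows "empirical_measure S n z = distr (uniform_count_measure {1..n}) (restrict_space borel S) z"
    (is "_ = ?D")
proof -
  have "measure_of S (sets (restrict_space borel S))
       (\<lambda>A. (\<Sum>i=1..n. emeasure (return (restrict_space borel S) (z i)) A) / of_nat n)
     = measure_of S (sets (restrict_space borel S)) (emeasure ?D)"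
  proof (rule measure_of_eq)
    show "sets (restrict_space borel S) \<subseteq> Pow S"
      using sets.space_closed[of "restrict_space borel S"] by (simp add: space_restrict_space)
    fix A assume "A \<in> sigma_sets S (sets (restrict_space borel S))"
    then have A: "A \<in> sets (restrict_space borel S)"
      using sets.sigma_sets_eq[of "restrict_space borel S"] by (simp add: space_restrict_space)
    define T where "T = {i \<in> {1..n}. z i \<in> A}"
    have "(\<Sum>i=1..n. emeasure (return (restrict_space borel S) (z i)) A) = (\<Sum>i\<in>{1..n}. indicator T i)"
      using A by (intro sum.cong) (auto simp: indicator_def T_def)
    also have "\<dots> = of_nat (card ({1..n} \<inter> T))"
      unfolding indicator_def by (subst sum_of_bool_eq) auto
    also have "{1..n} \<inter> T = z -` A \<inter> {1..n}" unfolding T_def by auto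
    also have "of_nat (card (z -` A \<inter> {1..n})) / of_nat n = emeasure ?D A"
      using A n by (simp add: emeasure_distr[OF measurable_uniform_count_measure[OF z]]
          space_uniform_count_measure emeasure_uniform_count_measure ennreal_of_nat_eq_real_of_nat
          divide_ennreal del: One_nat_def)
    finally show "(\<Sum>i=1..n. emeasure (return (restrict_space borel S) (z i)) A) / of_nat n = emeasure ?D A" .
  qed
  also have "\<dots> = ?D"
    using measure_of_of_measure[of ?D] by (simp add: space_restrict_space)
  finally show ?thesis unfolding empirical_measure_def .
qed

lemma empirical_measure_borel_probs:
  assumes "n \<ge> 1" and "z \<in> {1..n} \<rightarrow> S"
  shows "empirical_measure S n z \<in> borel_probs S"
proof -
  interpret prob_space "uniform_count_measure {1..n}"
    using assms(1) by (intro prob_space_uniform_count_measure) auto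
  show ?thesis
    unfolding borel_probs_def empirical_measure_eq_distr[OF assms]
    using prob_space_distr[OF measurable_uniform_count_measure[OF assms(2)]] by simp
qed

lemma integral_empirical_measure:
  fixes f :: "'s::topological_space \<Rightarrow> real"
  assumes "n \<ge> 1" and "z \<in> {1..n} \<rightarrow> S" and "f \<in> borel_measurable (restrict_space borel S)"
  shows "(\<integral>s. f s \<partial>empirical_measure S n z) = (\<Sum>i=1..n. f (z i)) / real n"
  unfolding empirical_measure_eq_distr[OF assms(1,2)]
  using integral_distr[OF measurable_uniform_count_measure[OF assms(2)] assms(3)]
  by (simp add: integral_uniform_count_measure)

lemma random_probs_empirical_measure:
  fixes S :: "'a::topological_space set"
  assumes n: "n \<ge> 1" and Z: "\<And>i. i \<ge> 1 \<Longrightarrow> Z i \<in> measurable M (restrict_space borel S)"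
  shows "random_probs M S (\<lambda>w. empirical_measure S n (\<lambda>i. Z i w))"
proof -
  have Z_in: "(\<lambda>i. Z i w) \<in> {1..n} \<rightarrow> S" if "w \<in> space M" for w
    using measurable_space[OF Z that] by (auto simp: space_restrict_space)
  have "(\<lambda>w. \<integral>s. f s \<partial>empirical_measure S n (\<lambda>i. Z i w)) \<in> borel_measurable M"
    if "continuous_on S f" for f :: "'a \<Rightarrow> real"
  proof -
    have f: "f \<in> borel_measurable (restrict_space borel S)"
      by (rule borel_measurable_continuous_on_restrict) fact
    have "(\<lambda>w. (\<Sum>i=1..n. f (Z i w)) / real n) \<in> borel_measurable M"
      by (intro borel_measurable_divide borel_measurable_sum measurable_compose[OF Z f]) auto
    moreover have "(\<integral>s. f s \<partial>empirical_measure S n (\<lambda>i. Z i w)) = (\<Sum>i=1..n. f (Z i w)) / real n"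
      if "w \<in> space M" for w
      by (rule integral_empirical_measure[OF n Z_in[OF that] f])
    ultimately show ?thesis by (simp cong: measurable_cong)
  qed
  moreover have "empirical_measure S n (\<lambda>i. Z i w) \<in> borel_probs S" if "w \<in> space M" for w
    by (rule empirical_measure_borel_probs[OF n Z_in[OF that]])
  ultimately show ?thesis unfolding random_probs_def by simp
qed

section \<open>Reproducing kernels and tangent inequalities of convex functions\<close>

lemma rkhs_bounded_linear: "rkhs app \<Longrightarrow> bounded_linear (\<lambda>f. app f x)"
  by (simp add: rkhs_def)

lemma eval_op_apply: "rkhs app \<Longrightarrow> blinfun_apply (eval_op app x) f = app f x"
  unfolding eval_op_def by (simp add: bounded_linear_Blinfun_apply rkhs_bounded_linear)

text \<open>The reproducing property for vector-valued functions: the feature map is the adjoint of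
  evaluation.\<close>

lemma feature_map_inner:
  assumes "rkhs app"
  shows "blinfun_apply (feature_map app x) v \<bullet> f = v \<bullet> app f x"
proof -
  have bl: "bounded_linear (blinfun_apply (eval_op app x))" by (rule blinfun.bounded_linear_right)
  have "blinfun_apply (feature_map app x) v = adjoint (blinfun_apply (eval_op app x)) v"
    unfolding feature_map_def using bounded_linear_adjoint[OF bl] by (simp add: bounded_linear_Blinfun_apply)
  then show ?thesis
    using inner_adjoint[OF bl, of f v] by (simp add: eval_op_apply[OF assms] inner_commute)
qed

text \<open>By the reproducing property the squared norm of the feature vector of \<open>v\<close>
  at \<open>x\<close> is \<open>v \<bullet> blinfun_apply (rkhs_kernel app x x) v\<close>.\<close>

lemma bounded_kernel_feature_map:
  assumes app: "rkhs app" and "bounded_kernel app"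
  obtains c where "0 \<le> c" "\<And>x v. norm (blinfun_apply (feature_map app x) v) \<le> c * norm v"
proof -
  obtain c where c: "\<And>x. sqrt (norm (rkhs_kernel app x x)) \<le> c"
    using assms(2) unfolding bounded_kernel_def bdd_above_def by auto
  have "0 \<le> c" using order_trans[OF _ c] by simp
  moreover have "norm (blinfun_apply (feature_map app x) v) \<le> c * norm v" for x v
  proof (rule power2_le_imp_le)
    let ?\<Phi> = "blinfun_apply (feature_map app x) v"
    have "(norm ?\<Phi>)\<^sup>2 = v \<bullet> app ?\<Phi> x"
      unfolding power2_norm_eq_inner by (rule feature_map_inner[OF app])
    also have "app ?\<Phi> x = blinfun_apply (rkhs_kernel app x x) v"
      unfolding rkhs_kernel_def by (simp add: eval_op_apply[OF app])
    also have "v \<bullet> \<dots> \<le> norm v * norm (blinfun_apply (rkhs_kernel app x x) v)"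
      by (rule norm_cauchy_schwarz)
    also have "\<dots> \<le> norm v * (norm (rkhs_kernel app x x) * norm v)"
      by (intro mult_left_mono norm_blinfun) simp
    also have "\<dots> = (sqrt (norm (rkhs_kernel app x x)))\<^sup>2 * (norm v)\<^sup>2"
      by (simp add: power2_eq_square)
    also have "\<dots> \<le> c\<^sup>2 * (norm v)\<^sup>2"
      by (intro mult_right_mono power_mono c) auto
    finally show "(norm ?\<Phi>)\<^sup>2 \<le> (c * norm v)\<^sup>2" by (simp add: power_mult_distrib)
  qed (use \<open>0 \<le> c\<close> in simp)
  ultimately show thesis by (rule that)
qed

text \<open>Restricted to the line through \<open>t\<close> and \<open>t'\<close>, this is the
  tangent inequality for a convex function of one real variable.\<close>

lemma convex_on_GDERIV_subgradient:
  fixes f :: "'a::real_inner \<Rightarrow> real"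
  assumes convex: "convex_on UNIV f" and deriv: "GDERIV f t :> D"
  shows "f t + D \<bullet> (t' - t) \<le> f t'"
proof -
  define h where "h = t' - t"
  define \<phi> where "\<phi> s = f (t + s *\<^sub>R h)" for s
  have "convex_on UNIV \<phi>"
  proof (rule convex_onI)
    fix u a b :: real assume u: "0 < u" "u < 1"
    have "t + ((1 - u) *\<^sub>R a + u *\<^sub>R b) *\<^sub>R h = (1 - u) *\<^sub>R (t + a *\<^sub>R h) + u *\<^sub>R (t + b *\<^sub>R h)"
      by (simp add: algebra_simps)
    then show "\<phi> ((1 - u) *\<^sub>R a + u *\<^sub>R b) \<le> (1 - u) * \<phi> a + u * \<phi> b"
      unfolding \<phi>_def using convex_onD[OF convex, of u "t + a *\<^sub>R h" "t + b *\<^sub>R h"] u by simp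
  qed auto
  moreover have "(\<phi> has_real_derivative D \<bullet> h) (at 0)"
  proof -
    have "((\<lambda>s. t + s *\<^sub>R h) has_derivative (\<lambda>s. s *\<^sub>R h)) (at 0)"
      by (auto intro!: derivative_eq_intros)
    moreover have "(f has_derivative (\<lambda>h. h \<bullet> D)) (at (t + 0 *\<^sub>R h))"
      using deriv by (simp add: gderiv_def)
    ultimately have "(\<phi> has_derivative (\<lambda>s. (s *\<^sub>R h) \<bullet> D)) (at 0)"
      unfolding \<phi>_def by (rule has_derivative_compose)
    moreover have "(\<lambda>s. (s *\<^sub>R h) \<bullet> D) = (*) (D \<bullet> h)"
      by (auto simp: inner_commute mult.commute)
    ultimately show ?thesis
      by (simp add: has_field_derivative_def)
  qed
  ultimately have "\<phi> 1 - \<phi> 0 \<ge> (D \<bullet> h) * (1 - 0)"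
    by (intro convex_on_imp_above_tangent[where A = UNIV]) auto
  then show ?thesis unfolding \<phi>_def h_def by simp
qed


section \<open>Kernel methods\<close>

definition rkhs_loss ::
  "('x \<Rightarrow> 'g \<Rightarrow> 'g \<Rightarrow> real) \<Rightarrow> ('h \<Rightarrow> 'x \<Rightarrow> 'g) \<Rightarrow> 'x \<times> 'g \<Rightarrow> 'h \<Rightarrow> real" where
  "rkhs_loss L app s f = L (fst s) (snd s) (app f (fst s))"

lemma rkhs_loss_measurable:
  fixes Y :: "'g::{real_inner, polish_space} set" and L :: "'x::polish_space \<Rightarrow> 'g \<Rightarrow> 'g \<Rightarrow> real"
  assumes "loss_function Y L" "continuous_on UNIV (app f)"
  shows "(\<lambda>s. rkhs_loss L app s f) \<in> borel_measurable (restrict_space borel (UNIV \<times> Y))"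
proof -
  have "continuous_on (UNIV \<times> Y) (\<lambda>s. (fst s, snd s, app f (fst s)))"
    by (intro continuous_intros continuous_on_compose2[OF assms(2)]) auto
  then have "(\<lambda>s. (fst s, snd s, app f (fst s))) \<in>
      measurable (restrict_space borel (UNIV \<times> Y)) (restrict_space borel (UNIV \<times> Y \<times> UNIV))"
    by (intro measurable_restrict_space2 borel_measurable_continuous_on_restrict)
      (auto simp: space_restrict_space)
  moreover have "(\<lambda>(x, y, t). L x y t) \<in> borel_measurable (restrict_space borel (UNIV \<times> Y \<times> UNIV))"
    using assms(1) by (simp add: loss_function_def)
  ultimately have "(\<lambda>s. case (fst s, snd s, app f (fst s)) of (x, y, t) \<Rightarrow> L x y t)
      \<in> borel_measurable (restrict_space borel (UNIV \<times> Y))"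
    by (rule measurable_compose)
  then show ?thesis by (simp add: rkhs_loss_def)
qed

text \<open>The Lipschitz condition restricts the distance of \<open>t\<close> and \<open>t'\<close>
  but not their location, so one radius bounds all gradients. The tangent inequality for a unit step
  along the gradient bounds its norm by a loss increment; \<open>a = 1\<close> admits that step. The
  maximum with 0 guards against a negative \<open>c\<close> when there are no quotients.\<close>

lemma locally_Lipschitz_loss_GDERIV_bounded:
  fixes L :: "'x \<Rightarrow> 'g::real_inner \<Rightarrow> 'g \<Rightarrow> real"
  assumes "locally_Lipschitz_loss Y L" "convex_loss Y L"
    and "\<And>x y t. y \<in> Y \<Longrightarrow> GDERIV (L x y) t :> grad x y t"
  obtains c where "0 \<le> c" "\<And>x y t. y \<in> Y \<Longrightarrow> norm (grad x y t) \<le> c"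
proof -
  have "bdd_above {\<bar>L x y t - L x y t'\<bar> / norm (t - t') | x y t t'.
      y \<in> Y \<and> 0 < norm (t - t') \<and> norm (t - t') \<le> 2 * 1}"
    using assms(1) unfolding locally_Lipschitz_loss_def by (elim allE[of _ 1]) simp
  then obtain c where "\<And>u. u \<in> {\<bar>L x y t - L x y t'\<bar> / norm (t - t') | x y t t'.
      y \<in> Y \<and> 0 < norm (t - t') \<and> norm (t - t') \<le> 2 * 1} \<Longrightarrow> u \<le> c"
    unfolding bdd_above_def by blast
  then have c: "\<bar>L x y t - L x y t'\<bar> / norm (t - t') \<le> c"
    if "y \<in> Y" "0 < norm (t - t')" "norm (t - t') \<le> 2 * 1" for x y t t'
    using that by blast
  have "norm (grad x y t) \<le> max 0 c" if y: "y \<in> Y" for x y t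
  proof (cases "grad x y t = 0")
    case False
    define h where "h = grad x y t /\<^sub>R norm (grad x y t)"
    have h: "norm h = 1" using False by (simp add: h_def)
    have "convex_on UNIV (L x y)" using assms(2) y by (simp add: convex_loss_def)
    then have "L x y t + grad x y t \<bullet> (t + h - t) \<le> L x y (t + h)"
      using assms(3)[OF y] by (rule convex_on_GDERIV_subgradient)
    moreover have "grad x y t \<bullet> h = norm (grad x y t)"
      using False by (simp add: h_def power2_norm_eq_inner[symmetric] power2_eq_square)
    ultimately have "norm (grad x y t) \<le> \<bar>L x y (t + h) - L x y t\<bar>" by simp
    also have "\<dots> \<le> c" using c[OF y, of "t + h" t x] h by simp
    finally show ?thesis by simp
  qed simp
  then show thesis by (intro that[of "max 0 c"]) auto
qed

lemma rkhs_loss_smooth_convex_risk: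
  fixes Y :: "'g::{real_inner, polish_space} set"
    and app :: "'h::{real_inner, polish_space} \<Rightarrow> 'x::polish_space \<Rightarrow> 'g"
    and L :: "'x \<Rightarrow> 'g \<Rightarrow> 'g \<Rightarrow> real"
  assumes app: "rkhs app" and cont: "\<And>f. continuous_on UNIV (app f)"
    and kernel: "bounded_kernel app" and feature: "continuous_on UNIV (feature_map app)"
    and loss: "loss_function Y L" and convex: "convex_loss Y L"
    and diff: "continuously_differentiable_loss Y L"
    and lip: "locally_Lipschitz_loss Y L" and bdd: "locally_bounded_loss Y L"
  obtains G B C where "smooth_convex_risk (UNIV \<times> Y) (rkhs_loss L app) G B C"
proof -
  obtain grad where grad: "\<And>x y t. y \<in> Y \<Longrightarrow> GDERIV (L x y) t :> grad x y t"
    and grad_cont: "continuous_on (UNIV \<times> Y \<times> UNIV) (\<lambda>(x, y, t). grad x y t)"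
    using diff unfolding continuously_differentiable_loss_def by blast
  obtain c where c: "0 \<le> c" "\<And>x y t. y \<in> Y \<Longrightarrow> norm (grad x y t) \<le> c"
    using locally_Lipschitz_loss_GDERIV_bounded[OF lip convex, of grad] grad by blast
  obtain \<kappa> where \<kappa>: "0 \<le> \<kappa>" "\<And>x v. norm (blinfun_apply (feature_map app x) v) \<le> \<kappa> * norm v"
    by (rule bounded_kernel_feature_map[OF app kernel]) blast
  have "bounded ((\<lambda>(x, y, t). L x y t) ` (UNIV \<times> Y \<times> {0}))"
    using bdd unfolding locally_bounded_loss_def by simp
  then obtain B where "\<And>u. u \<in> (\<lambda>(x, y, t). L x y t) ` (UNIV \<times> Y \<times> {0}) \<Longrightarrow> norm u \<le> B"
    unfolding bounded_iff by blast
  then have B: "\<bar>L x y 0\<bar> \<le> B" if "y \<in> Y" for x y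
    using that by (force simp: image_iff)
  define G where "G s f = blinfun_apply (feature_map app (fst s)) (grad (fst s) (snd s) (app f (fst s)))" for s f
  have "smooth_convex_risk (UNIV \<times> Y) (rkhs_loss L app) G B (\<kappa> * c)"
  proof
    show "(\<lambda>s. rkhs_loss L app s f) \<in> borel_measurable (restrict_space borel (UNIV \<times> Y))" for f
      by (rule rkhs_loss_measurable[OF loss cont])
    fix s :: "'x \<times> 'g" assume "s \<in> UNIV \<times> Y"
    then have s: "snd s \<in> Y" by auto
    show "0 \<le> rkhs_loss L app s f" for f
      using loss s by (simp add: rkhs_loss_def loss_function_def)
    show "rkhs_loss L app s 0 \<le> B"
      using B[OF s, of "fst s"] linear_0[OF bounded_linear.linear[OF rkhs_bounded_linear[OF app]], of "fst s"]
      by (simp add: rkhs_loss_def)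
    show "rkhs_loss L app s f + G s f \<bullet> (h - f) \<le> rkhs_loss L app s h" for f h
    proof -
      \<comment> \<open>The reproducing property turns \<open>G s f \<bullet> (h - f)\<close> into
        the loss gradient paired with this difference of values, so the tangent inequality of the
        loss applies.\<close>
      have "app (h - f) (fst s) = app h (fst s) - app f (fst s)"
        by (rule linear_diff[OF bounded_linear.linear[OF rkhs_bounded_linear[OF app]]])
      moreover have "convex_on UNIV (L (fst s) (snd s))" using convex s by (simp add: convex_loss_def)
      ultimately show ?thesis
        using convex_on_GDERIV_subgradient[OF _ grad[OF s], of "fst s" "app f (fst s)" "app h (fst s)"]
        by (simp add: rkhs_loss_def G_def feature_map_inner[OF app])
    qed
    show "norm (G s f) \<le> \<kappa> * c" for f
      unfolding G_def using \<kappa> c(2)[OF s] by (meson mult_left_mono order_trans)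
    show "continuous_on UNIV (G s)"
    proof -
      have "continuous_on UNIV (\<lambda>f. (fst s, snd s, app f (fst s)))"
        by (intro continuous_intros linear_continuous_on rkhs_bounded_linear[OF app])
      then have "continuous_on UNIV (\<lambda>f. grad (fst s) (snd s) (app f (fst s)))"
        using continuous_on_compose2[OF grad_cont, of UNIV "\<lambda>f. (fst s, snd s, app f (fst s))"] s
        by (simp add: image_subset_iff)
      then show ?thesis unfolding G_def by (intro continuous_intros)
    qed
  next
    show "0 \<le> \<kappa> * c" using \<kappa> c by simp
    fix f
    have "continuous_on (UNIV \<times> Y) (\<lambda>s. (fst s, snd s, app f (fst s)))"
      by (intro continuous_intros continuous_on_compose2[OF cont]) auto
    then have "continuous_on (UNIV \<times> Y) (\<lambda>s. grad (fst s) (snd s) (app f (fst s)))"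
      using continuous_on_compose2[OF grad_cont, of "UNIV \<times> Y" "\<lambda>s. (fst s, snd s, app f (fst s))"]
      by (simp add: image_subset_iff mem_Times_iff)
    then show "continuous_on (UNIV \<times> Y) (\<lambda>s. G s f)"
      unfolding G_def by (intro continuous_intros continuous_on_compose2[OF feature]) auto
  qed
  then show thesis by (rule that)
qed

section \<open>Identification of the SVM and of the optimal risk\<close>

context
  fixes Y :: "'g::{real_inner, polish_space} set"
    and app :: "'h::{real_inner, polish_space} \<Rightarrow> 'x::polish_space \<Rightarrow> 'g"
    and L :: "'x \<Rightarrow> 'g \<Rightarrow> 'g \<Rightarrow> real" and G B C
  assumes smooth: "smooth_convex_risk (UNIV \<times> Y) (rkhs_loss L app) G B C"
begin

interpretation smooth_convex_risk "UNIV \<times> Y" "rkhs_loss L app" G B C by (rule smooth)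

lemma risk_eq_erisk:
  assumes "I \<in> borel_probs (UNIV \<times> Y)"
  shows "risk L I (app f) = ennreal (erisk I f)"
proof -
  have "risk L I (app f) = (\<integral>\<^sup>+s. ennreal (rkhs_loss L app s f) \<partial>I)"
    unfolding risk_def rkhs_loss_def by (simp add: case_prod_unfold)
  also have "\<dots> = ennreal (erisk I f)"
    unfolding erisk_def
    by (intro nn_integral_eq_integral F_integrable assms AE_I2 F_nonneg) (simp add: borel_probsD[OF assms])
  finally show ?thesis .
qed

text \<open>Quadratic growth gives the uniqueness that the definite description in
  \<open>svm\<close> requires. Both terms of the objective are nonnegative, so it passes to extended
  reals without loss.\<close>

lemma svm_eq_minimizer:
  assumes I: "empirical_measure (UNIV \<times> Y) n z \<in> borel_probs (UNIV \<times> Y)" and lam: "lam > 0"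
  shows "svm Y L app n z lam = minimizer (empirical_measure (UNIV \<times> Y) n z) lam"
proof -
  let ?I = "empirical_measure (UNIV \<times> Y) n z" and ?p = "minimizer (empirical_measure (UNIV \<times> Y) n z) lam"
  have obj: "risk L ?I (app f) + ennreal (lam * (norm f)\<^sup>2) = ennreal (objective ?I lam f)" for f
    unfolding objective_def risk_eq_erisk[OF I] using lam erisk_nonneg[OF I]
    by (intro ennreal_plus[symmetric]) auto
  have nonneg: "0 \<le> objective ?I lam f" for f
    unfolding objective_def using erisk_nonneg[OF I] lam by simp
  show ?thesis
    unfolding svm_def obj
  proof (rule the_equality)
    show "is_arg_min (\<lambda>f. ennreal (objective ?I lam f)) (\<lambda>_. True) ?p"
      using objective_minimizer_le[OF I lam] by (auto simp: is_arg_min_linorder intro: ennreal_leI)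
    fix f assume "is_arg_min (\<lambda>f. ennreal (objective ?I lam f)) (\<lambda>_. True) f"
    then have "objective ?I lam f \<le> objective ?I lam ?p"
      using nonneg by (auto simp: is_arg_min_linorder)
    with objective_ge_minimizer[OF I lam, of f] have "lam / 2 * (norm (f - ?p))\<^sup>2 \<le> 0" by linarith
    then show "f = ?p" using lam by (simp add: mult_le_0_iff)
  qed
qed

text \<open>Richness reduces the infimum to the RKHS. The embedding into extended reals commutes
  with it because the risks of the minimizers for \<open>reg k\<close> converge to
  \<open>inf_risk J\<close>.\<close>

lemma optimal_risk_eq_inf_risk:
  assumes J: "J \<in> borel_probs (UNIV \<times> Y)" and "rich L app J"
  shows "optimal_risk L J = ennreal (inf_risk J)"
proof -
  have "(INF f. ennreal (erisk J f)) = ennreal (inf_risk J)"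
  proof (rule antisym)
    have "(\<lambda>k. ennreal (erisk J (minimizer J (reg k)))) \<longlonglongrightarrow> ennreal (inf_risk J)"
      by (intro tendsto_ennrealI erisk_minimizer_tendsto_inf_risk J reg_tendsto_0) simp
    then show "(INF f. ennreal (erisk J f)) \<le> ennreal (inf_risk J)"
      by (rule LIMSEQ_le_const) (auto intro: INF_lower)
    show "ennreal (inf_risk J) \<le> (INF f. ennreal (erisk J f))"
      by (intro INF_greatest ennreal_leI inf_risk_le J)
  qed
  then show ?thesis using assms(2) unfolding rich_def risk_eq_erisk[OF J] by simp
qed

end

lemma ennreal_dist_eq:
  assumes "0 \<le> b" "b \<le> a"
  shows "(ennreal a - ennreal b) + (ennreal b - ennreal a) = ennreal (a - b)"
  using assms by (simp add: ennreal_minus ennreal_neg)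

theorem theorem4p3:
  fixes M :: "'w measure"
    and Y :: "'g::{real_inner, polish_space} set"
    and app :: "'h::{real_inner, polish_space} \<Rightarrow> 'x::polish_space \<Rightarrow> 'g"
    and L :: "'x \<Rightarrow> 'g \<Rightarrow> 'g \<Rightarrow> real"
    and Z :: "nat \<Rightarrow> 'w \<Rightarrow> 'x \<times> 'g"
    and J :: "'w \<Rightarrow> ('x \<times> 'g) measure"
    and d :: "('x \<times> 'g) measure \<Rightarrow> ('x \<times> 'g) measure \<Rightarrow> real"
  assumes "complete_standard_borel_prob_space M"
    and "locally_compact_space (euclidean :: 'x topology)"
    and "Topological_Spaces.complete Y"
    and "rkhs app"
    and "\<And>f. continuous_on UNIV (app f)"
    and "bounded_kernel app"
    and "continuous_on UNIV (feature_map app)"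
    and "separable_space (mtopology_of
           (cfunspace (top_of_set (UNIV \<times> Y :: ('x \<times> 'g) set)) (euclidean_metric :: 'h metric)))"
    and "loss_function Y L"
    and "convex_loss Y L"
    and "continuously_differentiable_loss Y L"
    and "locally_Lipschitz_loss Y L"
    and "locally_bounded_loss Y L"
    and "\<And>n. n \<ge> 1 \<Longrightarrow> Z n \<in> measurable M (restrict_space borel (UNIV \<times> Y))"
    and "metrizes_weak_convergence (UNIV \<times> Y) d"
    and "random_measure M (UNIV \<times> Y) J"
    and "AE w in M. rich L app (J w)"
  shows "(ewc_in_prob M (UNIV \<times> Y) d Z J \<longrightarrow>
            (\<exists>lam :: nat \<Rightarrow> real. (\<forall>n\<ge>1. lam n > 0) \<and> lam \<longlonglongrightarrow> 0 \<and>
                svm_consistent M Y L app lam Z J)) \<and>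
         (ewc_almost_surely M (UNIV \<times> Y) d Z J \<longrightarrow>
            (\<exists>lam :: nat \<Rightarrow> real. (\<forall>n\<ge>1. lam n > 0) \<and> lam \<longlonglongrightarrow> 0 \<and>
                svm_strongly_consistent M Y L app lam Z J))"
proof -
  obtain M0 where "prob_space M0" "M = completion M0"
    using assms(1) unfolding complete_standard_borel_prob_space_def by blast
  then interpret prob_space M by (simp add: prob_space.prob_space_completion)
  interpret complete_measure M unfolding \<open>M = completion M0\<close> by (rule completion.complete_measure_axioms)
  obtain G B C where smooth: "smooth_convex_risk (UNIV \<times> Y) (rkhs_loss L app) G B C"
    by (rule rkhs_loss_smooth_convex_risk[OF assms(4-7,9-13)])
  interpret smooth_convex_risk "UNIV \<times> Y" "rkhs_loss L app" G B C by (rule smooth)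
  \<comment> \<open>Shifted by one, since the empirical measure is a probability measure only for positive
    sample sizes.\<close>
  define \<mu> where "\<mu> n w = empirical_measure (UNIV \<times> Y) (Suc n) (\<lambda>i. Z i w)" for n w
  define D where "D n w = d (\<mu> n w) (J w)" for n w
  have \<mu>: "random_probs M (UNIV \<times> Y) (\<mu> n)" for n
    unfolding \<mu>_def by (rule random_probs_empirical_measure) (use assms(14) in auto)
  have J: "random_probs M (UNIV \<times> Y) J"
    by (rule random_measure_imp_random_probs[OF assms(16)])
  note \<mu>_in = random_probs_borel_probs[OF \<mu>] and J_in = random_probs_borel_probs[OF J]
  interpret converging_risk "UNIV \<times> Y" "rkhs_loss L app" G B C M \<mu> J D
    by unfold_locales (auto simp: D_def intro!: \<mu> J metrizes_imp_weakly_converges[OF assms(15)] \<mu>_in J_in)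
  have D_nonneg: "0 \<le> D n w" for n w
    unfolding D_def
    by (rule Metric_space.nonneg[of "borel_probs (UNIV \<times> Y)"])
      (use assms(15) in \<open>simp add: metrizes_weak_convergence_def\<close>)
  have optimal: "AE w in M. optimal_risk L (J w) = ennreal (inf_risk (J w))"
    using assms(17) AE_space by eventually_elim (rule optimal_risk_eq_inf_risk[OF smooth J_in])
  have svm_risk: "svm_risk Y L app lam Z J (Suc n) w = ennreal (erisk (J w) (minimizer (\<mu> n w) (lam (Suc n))))"
    if "w \<in> space M" "lam (Suc n) > 0" for lam n w
    using svm_eq_minimizer[OF smooth, of "Suc n" "\<lambda>i. Z i w"] \<mu>_in[OF that(1), of n] that
    unfolding svm_risk_def \<mu>_def by (simp add: risk_eq_erisk[OF smooth J_in])
  have inf_nonneg: "0 \<le> inf_risk (J w)" if "w \<in> space M" for w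
    unfolding inf_risk_def by (rule cINF_greatest) (auto intro: erisk_nonneg J_in that)
  have reg_shift: "(\<lambda>n. reg (\<kappa> (n - 1))) \<longlonglongrightarrow> 0" if "filterlim \<kappa> at_top sequentially" for \<kappa>
    by (rule LIMSEQ_imp_Suc) (simp add: filterlim_compose[OF reg_tendsto_0 that])
  show ?thesis
  proof (intro conjI impI)
    assume "ewc_in_prob M (UNIV \<times> Y) d Z J"
    then have ewc: "\<And>n. n \<ge> 1 \<Longrightarrow> (\<lambda>w. ennreal (d (empirical_measure (UNIV \<times> Y) n (\<lambda>i. Z i w)) (J w))) \<in> borel_measurable M"
      "\<And>e. e > 0 \<Longrightarrow> (\<lambda>n. prob {w \<in> space M. ennreal (d (empirical_measure (UNIV \<times> Y) n (\<lambda>i. Z i w)) (J w)) > ennreal e}) \<longlonglongrightarrow> 0"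
      unfolding ewc_in_prob_def tends_to_0_in_prob_def by auto
    \<comment> \<open>The assumption speaks of the extended real distance; \<open>D\<close> is
      recovered from it by nonnegativity.\<close>
    have "(\<lambda>w. enn2real (ennreal (D n w))) \<in> borel_measurable M" for n
      unfolding D_def \<mu>_def by (intro borel_measurable_enn2real ewc(1)) simp
    then have D_measurable: "D n \<in> borel_measurable M" for n
      using D_nonneg by simp
    have D_lim: "(\<lambda>n. prob {w \<in> space M. D n w > e}) \<longlonglongrightarrow> 0" if "e > 0" for e
      using LIMSEQ_Suc[OF ewc(2)[OF that]] that
      unfolding D_def \<mu>_def by (simp add: ennreal_less_iff)
    obtain \<kappa> where \<kappa>: "filterlim \<kappa> at_top sequentially"
      and consistent: "\<forall>e>0. (\<lambda>n. prob {w \<in> space M.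
        suboptimality (\<mu> n w) (J w) (reg (\<kappa> n)) > e}) \<longlonglongrightarrow> 0"
      by (rule consistent_in_prob[OF D_measurable D_nonneg D_lim]) blast
    \<comment> \<open>Undoes the index shift: sample size \<open>Suc n\<close> uses
      \<open>\<kappa> n\<close>. Truncated subtraction gives a harmless value at 0.\<close>
    define lam where "lam n = reg (\<kappa> (n - 1))" for n
    define E where "E n w = (svm_risk Y L app lam Z J n w - optimal_risk L (J w)) +
       (optimal_risk L (J w) - svm_risk Y L app lam Z J n w)" for n w
    \<comment> \<open>The equality is only almost sure, because the optimal risk is identified with
      \<open>inf_risk\<close> only where richness holds.\<close>
    have E_eq: "AE w in M. ennreal (suboptimality (\<mu> n w) (J w) (reg (\<kappa> n))) = E (Suc n) w" for n
      using optimal AE_space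
    proof eventually_elim
      case (elim w)
      have "svm_risk Y L app lam Z J (Suc n) w = ennreal (erisk (J w) (minimizer (\<mu> n w) (reg (\<kappa> n))))"
        using svm_risk[OF elim(2), of lam n] by (simp add: lam_def)
      then show ?case
        unfolding E_def suboptimality_def elim(1)
        using ennreal_dist_eq[OF inf_nonneg[OF elim(2)] inf_risk_le[OF J_in[OF elim(2)]]] by simp
    qed
    have sub_measurable [measurable]:
      "(\<lambda>w. suboptimality (\<mu> n w) (J w) (reg (\<kappa> n))) \<in> borel_measurable M" for n
      by (rule suboptimality_measurable[OF \<mu> J]) simp
    have E_measurable: "E (Suc n) \<in> borel_measurable M" for n
      by (rule measurable_AE_cong[OF _ E_eq]) measurable
    have "(\<lambda>n. prob {w \<in> space M. E (Suc n) w > ennreal e}) \<longlonglongrightarrow> 0" if e: "e > 0" for e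
    proof -
      have "prob {w \<in> space M. E (Suc n) w > ennreal e} =
          prob {w \<in> space M. suboptimality (\<mu> n w) (J w) (reg (\<kappa> n)) > e}" for n
      proof (rule measure_eq_AE)
        show "AE w in M. w \<in> {w \<in> space M. E (Suc n) w > ennreal e} \<longleftrightarrow>
            w \<in> {w \<in> space M. suboptimality (\<mu> n w) (J w) (reg (\<kappa> n)) > e}"
          using E_eq[of n]
        proof eventually_elim
          case (elim w)
          show ?case using e by (simp add: elim[symmetric] ennreal_less_iff)
        qed
      qed (use E_measurable[of n] in measurable)
      then show ?thesis using consistent e by simp
    qed
    then have E_lim: "(\<lambda>n. prob {w \<in> space M. E n w > ennreal e}) \<longlonglongrightarrow> 0" if "e > 0" for e
      by (rule LIMSEQ_imp_Suc) (rule that)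
    have E_measurable': "E n \<in> borel_measurable M" if "n \<ge> 1" for n
      using E_measurable[of "n - 1"] that by simp
    have "svm_consistent M Y L app lam Z J"
      unfolding svm_consistent_def tends_to_0_in_prob_def E_def[symmetric]
      by (intro conjI allI impI E_measurable' E_lim)
    moreover have "lam \<longlonglongrightarrow> 0" unfolding lam_def by (rule reg_shift[OF \<kappa>])
    ultimately show "\<exists>lam. (\<forall>n\<ge>1. lam n > 0) \<and> lam \<longlonglongrightarrow> 0 \<and> svm_consistent M Y L app lam Z J"
      by (intro exI[of _ lam]) (simp add: lam_def)
  next
    assume "ewc_almost_surely M (UNIV \<times> Y) d Z J"
    then have "AE w in M. (\<lambda>n. d (empirical_measure (UNIV \<times> Y) n (\<lambda>i. Z i w)) (J w)) \<longlonglongrightarrow> 0"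
      by (simp add: ewc_almost_surely_def)
    then have D_lim: "AE w in M. (\<lambda>n. D n w) \<longlonglongrightarrow> 0"
      unfolding D_def \<mu>_def by eventually_elim (rule LIMSEQ_Suc)
    obtain \<kappa> where \<kappa>: "filterlim \<kappa> at_top sequentially"
      and consistent: "AE w in M. (\<lambda>n. suboptimality (\<mu> n w) (J w) (reg (\<kappa> n))) \<longlonglongrightarrow> 0"
      by (rule consistent_AE[OF D_lim])
    define lam where "lam n = reg (\<kappa> (n - 1))" for n
    have "svm_strongly_consistent M Y L app lam Z J"
      unfolding svm_strongly_consistent_def
      using consistent optimal AE_space
    proof eventually_elim
      case (elim w)
      have "(\<lambda>n. erisk (J w) (minimizer (\<mu> n w) (reg (\<kappa> n)))) \<longlonglongrightarrow> inf_risk (J w)"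
        using elim(1) unfolding suboptimality_def by (rule LIM_zero_cancel)
      then have "(\<lambda>n. svm_risk Y L app lam Z J (Suc n) w) \<longlonglongrightarrow> optimal_risk L (J w)"
        using svm_risk[OF elim(3), of lam] unfolding elim(2) by (simp add: lam_def tendsto_ennrealI)
      then show ?case by (rule LIMSEQ_imp_Suc)
    qed
    moreover have "lam \<longlonglongrightarrow> 0" unfolding lam_def by (rule reg_shift[OF \<kappa>])
    ultimately show "\<exists>lam. (\<forall>n\<ge>1. lam n > 0) \<and> lam \<longlonglongrightarrow> 0 \<and> svm_strongly_consistent M Y L app lam Z J"
      by (intro exI[of _ lam]) (simp add: lam_def)
  qed
qed

end
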